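(* Let $\mathbb{K}$ be an algebraically closed field, let $q\in\mathbb{K}^*$ be such that $q^2$ is a primitive $l$-th root of unity with $l>1$, and let $\alpha,\beta,\gamma\in\mathbb{K}$ with $\beta\neq0$. Then each simple $A(\alpha,\beta,\gamma)$-module on which $z$ acts nilpotently is isomorphic to the simple $A(\alpha,\beta,\gamma)$-module $M_4(\mu_1,\mu_2)$ for some $(\mu_1,\mu_2)\in\mathbb{K}^2$.
   Context: For $\alpha,\beta,\gamma\in\mathbb{K}$ and $q\in\mathbb{K}^*$, $A(\alpha,\beta,\gamma)$ is the associative unital $\mathbb{K}$-algebra generated by $x,y,z$ subject to $xy=q^2yx+\alpha$, $xz=q^{-2}zx+\beta$, $yz=q^2zy+\gamma$. Modules are right modules (so in $m\,xy$ the element $x$ acts first). $M_4(\mu_1,\mu_2)$, for $(\mu_1,\mu_2)\in\mathbb{K}^2$ (and $\beta\ne0$): the $\mathbb{K}$-vector space with basis $m_k$, $0\le k\le l-1$, with $$m_kx=m_{k+1}\ (k\neq l-1),\qquad m_{l-1}x=\mu_1m_0,$$ $$m_ky=\gamma\beta^{-1}q^{2k}m_{k+1}-\mu_2\beta^{-1}q^{2k}(q^2-1)m_k+\tfrac{1-q^{2k}}{1-q^2}\alpha m_{k-1}\quad(k\neq0,l-1),$$ $$m_{l-1}y=\gamma\beta^{-1}\mu_1q^{2(l-1)}m_0-\mu_2\beta^{-1}q^{2(l-1)}(q^2-1)m_{l-1}+\tfrac{1-q^{2(l-1)}}{1-q^2}\alpha m_{l-2},$$ $$m_0y=\gamma\beta^{-1}m_1-\mu_2\beta^{-1}(q^2-1)m_0,$$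 $$m_kz=\beta\tfrac{1-q^{-2k}}{1-q^{-2}}m_{k-1}\ (k\neq0),\qquad m_0z=0.$$ *)

theory Defs
  imports
    "HOL-Algebra.Algebra"
    "HOL-Algebra.Algebraic_Closure_Type"
    "HOL-Library.Poly_Mapping"
    "HOL-Computational_Algebra.Polynomial"
begin

definition primitive_root_of_unity :: "nat \<Rightarrow> 'k::field \<Rightarrow> bool" where
  "primitive_root_of_unity n \<zeta> \<longleftrightarrow> n > 0 \<and> \<zeta> ^ n = 1 \<and> (\<forall>j. 0 < j \<and> j < n \<longrightarrow> \<zeta> ^ j \<noteq> 1)"


section \<open>Right modules\<close>

record ('a, 'm) rmodule = "'m ring" +
  ract :: "'m \<Rightarrow> 'a \<Rightarrow> 'm" (infixl \<open>\<triangleleft>\<index>\<close> 70)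

text \<open>As for modules in HOL-Algebra, the multiplicative part of the record \<open>M\<close> is irrelevant.\<close>

locale right_module = R?: ring R + M?: abelian_group M
  for R :: "('a, 'c) ring_scheme" (structure) and M :: "('a, 'm, 'd) rmodule_scheme" (structure) +
  assumes ract_closed:
      "m \<in> carrier M \<Longrightarrow> a \<in> carrier R \<Longrightarrow> m \<triangleleft>\<^bsub>M\<^esub> a \<in> carrier M"
    and ract_add_left:
      "m \<in> carrier M \<Longrightarrow> n \<in> carrier M \<Longrightarrow> a \<in> carrier R \<Longrightarrow>
        (m \<oplus>\<^bsub>M\<^esub> n) \<triangleleft>\<^bsub>M\<^esub> a = m \<triangleleft>\<^bsub>M\<^esub> a \<oplus>\<^bsub>M\<^esub> n \<triangleleft>\<^bsub>M\<^esub> a"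
    and ract_add_right:
      "m \<in> carrier M \<Longrightarrow> a \<in> carrier R \<Longrightarrow> b \<in> carrier R \<Longrightarrow>
        m \<triangleleft>\<^bsub>M\<^esub> (a \<oplus> b) = m \<triangleleft>\<^bsub>M\<^esub> a \<oplus>\<^bsub>M\<^esub> m \<triangleleft>\<^bsub>M\<^esub> b"
    and ract_mult:
      "m \<in> carrier M \<Longrightarrow> a \<in> carrier R \<Longrightarrow> b \<in> carrier R \<Longrightarrow>
        m \<triangleleft>\<^bsub>M\<^esub> (a \<otimes> b) = (m \<triangleleft>\<^bsub>M\<^esub> a) \<triangleleft>\<^bsub>M\<^esub> b"
    and ract_one:
      "m \<in> carrier M \<Longrightarrow> m \<triangleleft>\<^bsub>M\<^esub> \<one> = m"

definition right_submodule ::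
    "('a, 'c) ring_scheme \<Rightarrow> ('a, 'm, 'd) rmodule_scheme \<Rightarrow> 'm set \<Rightarrow> bool" where
  "right_submodule R M N \<longleftrightarrow>
     additive_subgroup N M \<and> (\<forall>n\<in>N. \<forall>a\<in>carrier R. n \<triangleleft>\<^bsub>M\<^esub> a \<in> N)"

definition simple_right_module ::
    "('a, 'c) ring_scheme \<Rightarrow> ('a, 'm, 'd) rmodule_scheme \<Rightarrow> bool" where
  "simple_right_module R M \<longleftrightarrow>
     right_module R M \<and> carrier M \<noteq> {\<zero>\<^bsub>M\<^esub>} \<and>
     (\<forall>N. right_submodule R M N \<longrightarrow> N = {\<zero>\<^bsub>M\<^esub>} \<or> N = carrier M)"

definition right_module_iso ::
    "('a, 'c) ring_scheme \<Rightarrow> ('a, 'm, 'd) rmodule_scheme \<Rightarrow> ('a, 'n, 'e) rmodule_scheme \<Rightarrow>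
      ('m \<Rightarrow> 'n) set" where
  "right_module_iso R M N =
     {f. bij_betw f (carrier M) (carrier N) \<and>
         (\<forall>m\<in>carrier M. \<forall>n\<in>carrier M. f (m \<oplus>\<^bsub>M\<^esub> n) = f m \<oplus>\<^bsub>N\<^esub> f n) \<and>
         (\<forall>m\<in>carrier M. \<forall>a\<in>carrier R. f (m \<triangleleft>\<^bsub>M\<^esub> a) = f m \<triangleleft>\<^bsub>N\<^esub> a)}"

definition right_modules_isomorphic ::
    "('a, 'c) ring_scheme \<Rightarrow> ('a, 'm, 'd) rmodule_scheme \<Rightarrow> ('a, 'n, 'e) rmodule_scheme \<Rightarrow> bool" where
  "right_modules_isomorphic R M N \<longleftrightarrow>
     right_module R M \<and> right_module R N \<and> right_module_iso R M N \<noteq> {}"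

definition acts_nilpotently :: "('a, 'c) ring_scheme \<Rightarrow> ('a, 'm, 'd) rmodule_scheme \<Rightarrow> 'a \<Rightarrow> bool" where
  "acts_nilpotently R M a \<longleftrightarrow>
     (\<exists>n::nat. \<forall>m\<in>carrier M. m \<triangleleft>\<^bsub>M\<^esub> (a [^]\<^bsub>R\<^esub> n) = \<zero>\<^bsub>M\<^esub>)"


section \<open>The free algebra on three generators\<close>

datatype gen = GX | GY | GZ

text \<open>The free monoid on the generators, written additively so that the convolution product of
  \<open>word \<Rightarrow>\<^sub>0 'k\<close> is the product of the free associative unital algebra.\<close>

datatype word = Word (letters: "gen list")

instantiation word :: monoid_add
begin

definition zero_word :: word where "0 = Word []"

definition plus_word :: "word \<Rightarrow> word \<Rightarrow> word" where
  "u + v = Word (letters u @ letters v)"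

instance by standard (simp_all add: zero_word_def plus_word_def)

end

type_synonym 'k free_alg = "word \<Rightarrow>\<^sub>0 'k"

abbreviation free_ring :: "'k::field free_alg ring" where
  "free_ring \<equiv> ring_of_type_algebra"

definition free_gen :: "gen \<Rightarrow> 'k::field free_alg" where
  "free_gen g = Poly_Mapping.single (Word [g]) 1"

definition free_const :: "'k::field \<Rightarrow> 'k free_alg" where
  "free_const c = Poly_Mapping.single 0 c"


section \<open>The algebra \<open>A(\<alpha>, \<beta>, \<gamma>)\<close>\<close>

definition A_relators :: "'k::field \<Rightarrow> 'k \<Rightarrow> 'k \<Rightarrow> 'k \<Rightarrow> 'k free_alg set" where
  "A_relators q \<alpha> \<beta> \<gamma> =
     (let x = free_gen GX; y = free_gen GY; z = free_gen GZ in
      {x * y - (free_const (q ^ 2) * (y * x) + free_const \<alpha>),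
       x * z - (free_const (q powi - 2) * (z * x) + free_const \<beta>),
       y * z - (free_const (q ^ 2) * (z * y) + free_const \<gamma>)})"

definition A_ideal :: "'k::field \<Rightarrow> 'k \<Rightarrow> 'k \<Rightarrow> 'k \<Rightarrow> 'k free_alg set" where
  "A_ideal q \<alpha> \<beta> \<gamma> = genideal free_ring (A_relators q \<alpha> \<beta> \<gamma>)"

definition A_alg :: "'k::field \<Rightarrow> 'k \<Rightarrow> 'k \<Rightarrow> 'k \<Rightarrow> 'k free_alg set ring" where
  "A_alg q \<alpha> \<beta> \<gamma> = free_ring Quot A_ideal q \<alpha> \<beta> \<gamma>"

definition A_gen :: "'k::field \<Rightarrow> 'k \<Rightarrow> 'k \<Rightarrow> 'k \<Rightarrow> gen \<Rightarrow> 'k free_alg set" where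
  "A_gen q \<alpha> \<beta> \<gamma> g = A_ideal q \<alpha> \<beta> \<gamma> +>\<^bsub>free_ring\<^esub> free_gen g"


section \<open>The modules \<open>M\<^sub>4(\<mu>\<^sub>1, \<mu>\<^sub>2)\<close>\<close>

definition vscale :: "'k::field \<Rightarrow> (nat \<Rightarrow>\<^sub>0 'k) \<Rightarrow> (nat \<Rightarrow>\<^sub>0 'k)" where
  "vscale c v = Poly_Mapping.map (\<lambda>a. c * a) v"

definition vbasis :: "nat \<Rightarrow> (nat \<Rightarrow>\<^sub>0 'k::field)" where
  "vbasis k = Poly_Mapping.single k 1"

definition linear_ext :: "(nat \<Rightarrow> (nat \<Rightarrow>\<^sub>0 'k::field)) \<Rightarrow> (nat \<Rightarrow>\<^sub>0 'k) \<Rightarrow> (nat \<Rightarrow>\<^sub>0 'k)" where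
  "linear_ext \<phi> v = (\<Sum>k\<in>Poly_Mapping.keys v. vscale (Poly_Mapping.lookup v k) (\<phi> k))"

definition M4_x :: "nat \<Rightarrow> 'k::field \<Rightarrow> nat \<Rightarrow> (nat \<Rightarrow>\<^sub>0 'k)" where
  "M4_x l \<mu>1 k = (if k = l - 1 then vscale \<mu>1 (vbasis 0) else vbasis (k + 1))"

definition M4_y ::
    "nat \<Rightarrow> 'k::field \<Rightarrow> 'k \<Rightarrow> 'k \<Rightarrow> 'k \<Rightarrow> 'k \<Rightarrow> 'k \<Rightarrow> nat \<Rightarrow> (nat \<Rightarrow>\<^sub>0 'k)" where
  "M4_y l q \<alpha> \<beta> \<gamma> \<mu>1 \<mu>2 k =
     (if k = 0 then
        vscale (\<gamma> * inverse \<beta>) (vbasis 1)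
        - vscale (\<mu>2 * inverse \<beta> * (q ^ 2 - 1)) (vbasis 0)
      else if k = l - 1 then
        vscale (\<gamma> * inverse \<beta> * \<mu>1 * q ^ (2 * (l - 1))) (vbasis 0)
        - vscale (\<mu>2 * inverse \<beta> * q ^ (2 * (l - 1)) * (q ^ 2 - 1)) (vbasis (l - 1))
        + vscale ((1 - q ^ (2 * (l - 1))) / (1 - q ^ 2) * \<alpha>) (vbasis (l - 2))
      else
        vscale (\<gamma> * inverse \<beta> * q ^ (2 * k)) (vbasis (k + 1))
        - vscale (\<mu>2 * inverse \<beta> * q ^ (2 * k) * (q ^ 2 - 1)) (vbasis k)
        + vscale ((1 - q ^ (2 * k)) / (1 - q ^ 2) * \<alpha>) (vbasis (k - 1)))"

definition M4_z :: "'k::field \<Rightarrow> 'k \<Rightarrow> nat \<Rightarrow> (nat \<Rightarrow>\<^sub>0 'k)" where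
  "M4_z q \<beta> k =
     (if k = 0 then 0
      else vscale (\<beta> * ((1 - q powi (- 2 * int k)) / (1 - q powi - 2))) (vbasis (k - 1)))"

definition M4_gen ::
    "nat \<Rightarrow> 'k::field \<Rightarrow> 'k \<Rightarrow> 'k \<Rightarrow> 'k \<Rightarrow> 'k \<Rightarrow> 'k \<Rightarrow> gen \<Rightarrow> (nat \<Rightarrow>\<^sub>0 'k) \<Rightarrow> (nat \<Rightarrow>\<^sub>0 'k)" where
  "M4_gen l q \<alpha> \<beta> \<gamma> \<mu>1 \<mu>2 g =
     linear_ext (case g of GX \<Rightarrow> M4_x l \<mu>1 | GY \<Rightarrow> M4_y l q \<alpha> \<beta> \<gamma> \<mu>1 \<mu>2 | GZ \<Rightarrow> M4_z q \<beta>)"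

text \<open>The action of the free algebra: as befits a right action, \<^const>\<open>fold\<close> applies the first
  letter of a word first.\<close>

definition M4_free_act ::
    "nat \<Rightarrow> 'k::field \<Rightarrow> 'k \<Rightarrow> 'k \<Rightarrow> 'k \<Rightarrow> 'k \<Rightarrow> 'k \<Rightarrow> (nat \<Rightarrow>\<^sub>0 'k) \<Rightarrow> 'k free_alg \<Rightarrow> (nat \<Rightarrow>\<^sub>0 'k)" where
  "M4_free_act l q \<alpha> \<beta> \<gamma> \<mu>1 \<mu>2 v p =
     (\<Sum>w\<in>Poly_Mapping.keys p. vscale (Poly_Mapping.lookup p w)
        (fold (M4_gen l q \<alpha> \<beta> \<gamma> \<mu>1 \<mu>2) (letters w) v))"

text \<open>The basis is \<open>m\<^sub>k = vbasis k\<close> for \<open>k < l\<close>. An element of \<open>A(\<alpha>, \<beta>, \<gamma>)\<close> is a coset, all of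
  whose members act in the same way on the carrier when \<open>\<beta> \<noteq> 0\<close> and \<open>q\<^sup>2\<close> is a primitive
  \<open>l\<close>-th root of unity with \<open>l > 1\<close>; \<^const>\<open>the_elem\<close> selects their common value.\<close>

definition M4 ::
    "nat \<Rightarrow> 'k::field \<Rightarrow> 'k \<Rightarrow> 'k \<Rightarrow> 'k \<Rightarrow> 'k \<Rightarrow> 'k \<Rightarrow> ('k free_alg set, nat \<Rightarrow>\<^sub>0 'k) rmodule" where
  "M4 l q \<alpha> \<beta> \<gamma> \<mu>1 \<mu>2 =
     \<lparr>carrier = {v. Poly_Mapping.keys v \<subseteq> {..<l}},
      monoid.mult = (\<lambda>_ _. undefined), one = undefined,
      ring.zero = 0, add = (+),
      ract = (\<lambda>v a. the_elem (M4_free_act l q \<alpha> \<beta> \<gamma> \<mu>1 \<mu>2 v ` a))\<rparr>"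

end

theory Submission
  imports Defs
begin

text \<open>
  Put \<open>p = q\<^sup>2\<close>, \<open>C = x\<^sup>l\<close> and \<open>T = \<gamma> x - \<beta> y\<close>. The element \<open>C\<close> is central, and both \<open>T\<close> and
  \<open>C\<close> preserve the kernel \<open>V\<close> of \<open>z\<close> on a simple module. If \<open>W \<subseteq> V\<close> is stable under \<open>T\<close> and \<open>C\<close>,
  then \<open>\<Sum>\<^sub>k W x\<^sup>k\<close> with \<open>k < l\<close> is a submodule and the sum is direct, because \<open>z\<close> maps \<open>W x\<^sup>k\<close> to
  \<open>W x\<^bsup>k-1\<^esup>\<close> by a nonzero multiple of the obvious map. Hence \<open>V\<close> is a simple module over the
  polynomial ring in \<open>T\<close> and \<open>C\<close>. By the weak Nullstellensatz in two variables, it is spanned by a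
  common eigenvector \<open>v\<close>, and \<open>m\<^sub>k \<mapsto> v x\<^sup>k\<close> is the required isomorphism; \<open>\<mu>\<^sub>1\<close> is the eigenvalue of
  \<open>C\<close> and \<open>\<mu>\<^sub>2 (p - 1)\<close> that of \<open>T\<close>.

  The simple module is presented as a quotient of the free algebra by a maximal right ideal \<open>J\<close>, so
  that its elements become congruence classes of elements of a type.
\<close>

section \<open>The weak Nullstellensatz in two variables\<close>

text \<open>A root of \<open>p\<close> splits off a linear factor, and primality of \<open>I\<close>
  puts either that factor or the cofactor into \<open>I\<close>; the degree drops until only a
  nonzero constant is left. The map \<open>h\<close> is kept abstract because it serves both for
  polynomials in the inner variable and for polynomials in the outer one.\<close>

lemma prime_ideal_poly_has_linear:
  fixes I :: "'a::idom set" and h :: "'k::alg_closed_field poly \<Rightarrow> 'a"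
  assumes h_mult: "\<And>p q. h (p * q) = h p * h q"
    and h_one: "\<And>c. c \<noteq> 0 \<Longrightarrow> h [:c:] \<notin> I"
    and prime: "\<And>a b. a * b \<in> I \<Longrightarrow> a \<in> I \<or> b \<in> I"
    and "p \<noteq> 0" "h p \<in> I"
  shows "\<exists>c. h [:-c, 1:] \<in> I"
  using assms(4,5)
proof (induction "degree p" arbitrary: p)
  case 0
  then obtain c where "p = [:c:]" by (metis degree_eq_zeroE)
  then show ?case using 0 h_one by auto
next
  case (Suc n)
  then obtain c where "poly p c = 0" by (metis alg_closed_imp_poly_has_root zero_less_Suc)
  then obtain r where r: "p = [:-c, 1:] * r" by (metis poly_eq_0_iff_dvd dvdE)
  then have "r \<noteq> 0" using Suc.prems by auto
  then have "degree r = n" using Suc.hyps(2) r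
    by (metis add_left_imp_eq degree_linear_power degree_mult_eq pCons_eq_0_iff plus_1_eq_Suc power_one_right zero_neq_one)
  then show ?case using Suc.hyps(1)[of r] prime \<open>r \<noteq> 0\<close> Suc.prems(2) r h_mult by metis
qed

text \<open>\<open>pCons 1 p\<close> is 1 + t p(t), and a root of it cannot be a root of
  \<open>p\<close>.\<close>

lemma alg_closed_exists_nonroot:
  fixes p :: "'k::alg_closed_field poly"
  assumes "p \<noteq> 0"
  shows "\<exists>c. poly p c \<noteq> 0"
proof -
  have "degree (pCons 1 p) > 0" using assms by simp
  then obtain c where "poly (pCons 1 p) c = 0" using alg_closed_imp_poly_has_root by blast
  then show ?thesis by (intro exI[of _ c]) auto
qed

text \<open>Write t for the inner and x for the outer variable. The assumptions describe a maximal
  ideal of K[t][x], and the conclusion puts t - a and x - b into it. An argument with an element of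
  minimal degree in x yields t - a; modulo it only polynomials in x remain, and the one-variable
  argument applies to them.\<close>

lemma weak_nullstellensatz_two_variables:
  fixes I :: "'k::alg_closed_field poly poly set"
  assumes add: "\<And>P Q. P \<in> I \<Longrightarrow> Q \<in> I \<Longrightarrow> P + Q \<in> I"
    and mult: "\<And>P Q. P \<in> I \<Longrightarrow> P * Q \<in> I"
    and proper: "1 \<notin> I"
    and maximal: "\<And>P. P \<notin> I \<Longrightarrow> \<exists>Q. P * Q - 1 \<in> I"
  shows "\<exists>a b. [:[:-a, 1:]:] \<in> I \<and> [:[:-b:], 1:] \<in> I"
proof -
  have mult': "Q * P \<in> I" if "P \<in> I" for P Q
    using mult[OF that, of Q] by (simp add: mult.commute)
  have uminus: "- P \<in> I" if "P \<in> I" for P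
    using mult[OF that, of "-1"] by simp
  have diff: "P - Q \<in> I" if "P \<in> I" "Q \<in> I" for P Q
    using add[OF that(1) uminus[OF that(2)]] by simp
  have prime: "P \<in> I \<or> Q \<in> I" if "P * Q \<in> I" for P Q
  proof (rule disjCI)
    assume "Q \<notin> I"
    then obtain R where "Q * R - 1 \<in> I" using maximal by blast
    then have "P * Q * R - P * (Q * R - 1) \<in> I" using that mult mult' diff by blast
    then show "P \<in> I" by (simp add: algebra_simps)
  qed
  have const: "[:[:c:]:] \<notin> I" if "c \<noteq> 0" for c
  proof
    assume "[:[:c:]:] \<in> I"
    from mult[OF this, of "[:[:inverse c:]:]"] show False using that proper
      by (simp add: one_pCons)
  qed
  have "\<exists>a. [:[:-a, 1:]:] \<in> I"
  proof (rule ccontr)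
    assume none: "\<nexists>a. [:[:-a, 1:]:] \<in> I"
    have t_free: "[:f:] \<notin> I" if "f \<noteq> 0" for f
      using prime_ideal_poly_has_linear[of "\<lambda>f. [:f:]" I f] that none prime const by auto
    \<comment> \<open>Either x lies in \<open>I\<close>, or x is invertible modulo \<open>I\<close>,
      and then x P - 1 has constant coefficient -1.\<close>
    have "\<exists>Q. Q \<in> I \<and> Q \<noteq> 0"
    proof (cases "[:0, 1:] \<in> I")
      case False
      then obtain P where "[:0, 1:] * P - 1 \<in> I" using maximal by blast
      moreover have "coeff ([:0, 1:] * P - 1) 0 \<noteq> 0" by simp
      ultimately show ?thesis by fastforce
    qed fastforce
    then obtain Q where Q: "Q \<in> I" "Q \<noteq> 0"
      and min: "\<And>R. R \<in> I \<Longrightarrow> R \<noteq> 0 \<Longrightarrow> degree Q \<le> degree R"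
      using ex_has_least_nat[of "\<lambda>Q. Q \<in> I \<and> Q \<noteq> 0" _ degree] by blast
    have degQ: "degree Q > 0"
    proof (rule ccontr)
      assume "\<not> ?thesis"
      then obtain f where "Q = [:f:]" by (metis degree_eq_zeroE neq0_conv)
      then show False using Q t_free by auto
    qed
    obtain c where c: "poly (lead_coeff Q) c \<noteq> 0"
      using alg_closed_exists_nonroot[of "lead_coeff Q"] Q by auto
    obtain P where P: "[:[:-c, 1:]:] * P - 1 \<in> I" using none maximal by blast
    define R where "R = pseudo_mod P Q"
    obtain S j where S: "smult (lead_coeff Q ^ j) P = Q * S + R"
      and degR: "R = 0 \<or> degree R < degree Q"
      using pseudo_divmod[OF Q(2), of P "fst (pseudo_divmod P Q)" R]
      by (auto simp: R_def pseudo_mod_def)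
    \<comment> \<open>\<open>P\<close> inverts t - c modulo \<open>I\<close>. After multiplication
      by a power of the leading coefficient of \<open>Q\<close> it can be replaced by its remainder
      \<open>R\<close>, so \<open>D\<close> lies in \<open>I\<close>, has smaller degree than
      \<open>Q\<close> and must vanish. Its coefficient at x^0, evaluated at t = c, then contradicts
      the choice of \<open>c\<close> off the roots of the leading coefficient.\<close>
    define D where "D = [:lead_coeff Q ^ j:] - [:[:-c, 1:]:] * R"
    have "[:lead_coeff Q ^ j:] * P = Q * S + R" using S by simp
    moreover have "A - B * R = B * (Q * S) - A * (B * P - 1)" if "A * P = Q * S + R"
      for A B :: "'k poly poly"
    proof -
      have "R = A * P - Q * S" using that by simp
      then show ?thesis by (simp only:) (simp add: algebra_simps)
    qed
    ultimately have "D = [:[:-c, 1:]:] * (Q * S) - [:lead_coeff Q ^ j:] * ([:[:-c, 1:]:] * P - 1)"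
      unfolding D_def by blast
    then have "D \<in> I" using P Q mult mult' diff by metis
    moreover have "degree D < degree Q"
      unfolding D_def using degR degQ
      by (intro degree_diff_less) (auto intro: le_less_trans[OF degree_smult_le])
    ultimately have "D = 0" using min by fastforce
    then have "coeff D 0 = 0" by simp
    then have "lead_coeff Q ^ j = [:-c, 1:] * coeff R 0" by (simp add: D_def)
    then have "poly (lead_coeff Q ^ j) c = 0" by simp
    then show False using c by simp
  qed
  then obtain a where a: "[:[:-a, 1:]:] \<in> I" by blast
  \<comment> \<open>\<open>e\<close> embeds K[x] into K[t][x].\<close>
  define e where "e g = map_poly (\<lambda>c. [:c:]) g" for g :: "'k poly"
  have e_0: "e 0 = 0" by (simp add: e_def)
  have e_pCons: "e (pCons c g) = pCons [:c:] (e g)" for c g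
    by (cases "pCons c g = 0") (auto simp: e_def map_poly_pCons)
  have e_add: "e (f + g) = e f + e g" for f g
    by (induction f g rule: poly_induct2) (simp_all add: e_pCons e_0)
  have e_smult: "e (smult c g) = smult [:c:] (e g)" for c g
    by (induction g) (simp_all add: e_pCons e_0)
  have e_mult: "e (f * g) = e f * e g" for f g
    by (induction f) (simp_all add: e_pCons e_0 e_add e_smult)
  \<comment> \<open>Modulo t - a each coefficient may be replaced by its value at
    \<open>a\<close>.\<close>
  have red: "\<exists>g. P - e g \<in> I" for P
  proof (induction P)
    case 0
    show ?case using diff[OF a a] e_0 by (intro exI[of _ 0]) simp
  next
    case (pCons f P)
    then obtain g where g: "P - e g \<in> I" by blast
    have "[:-a, 1:] dvd f - [:poly f a:]" by (simp flip: poly_eq_0_iff_dvd)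
    then obtain r where r: "f - [:poly f a:] = [:-a, 1:] * r" by (elim dvdE)
    have "[:f - [:poly f a:]:] \<in> I" unfolding r using mult[OF a, of "[:r:]"] by simp
    from add[OF this mult'[OF g, of "[:0, 1:]"]]
    show ?case by (intro exI[of _ "pCons (poly f a) g"]) (simp add: e_pCons)
  qed
  \<comment> \<open>If x is not in \<open>I\<close>, its inverse modulo \<open>I\<close> reduces to
    some \<open>e g\<close>, and x g - 1 is a nonzero polynomial of the required kind.\<close>
  have "\<exists>f. f \<noteq> 0 \<and> e f \<in> I"
  proof (cases "[:0, 1:] \<in> I")
    case True
    then show ?thesis by (intro exI[of _ "[:0, 1:]"]) (simp add: e_pCons e_0 one_pCons)
  next
    case False
    then obtain P where P: "[:0, 1:] * P - 1 \<in> I" using maximal by blast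
    obtain g where g: "P - e g \<in> I" using red by blast
    have "([:0, 1:] * P - 1) - [:0, 1:] * (P - e g) \<in> I" using P g mult' diff by blast
    moreover have "([:0, 1:] * P - 1) - [:0, 1:] * (P - e g) = e (pCons (-1) g)"
      by (simp add: algebra_simps e_pCons flip: one_pCons)
        (simp add: one_pCons)
    ultimately show ?thesis by (metis pCons_eq_0_iff neg_equal_0_iff_equal zero_neq_one)
  qed
  then have "\<exists>b. e [:-b, 1:] \<in> I"
    using prime_ideal_poly_has_linear[of e I] e_mult const prime by (auto simp: e_pCons e_0)
  then obtain b where "e [:-b, 1:] \<in> I" ..
  then have "[:[:-b:], 1:] \<in> I" by (simp add: e_def map_poly_pCons one_pCons)
  then show ?thesis using a by blast
qed

section \<open>Congruences modulo a right ideal\<close>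

text \<open>Evaluation at \<open>t\<close>, with the images of the coefficients written to the left
  of the powers of \<open>t\<close>. As \<open>h\<close> is an arbitrary function, evaluations can
  be nested, which covers polynomials in two variables.\<close>

definition horner :: "('c::zero \<Rightarrow> 'a::ring_1) \<Rightarrow> 'a \<Rightarrow> 'c poly \<Rightarrow> 'a" where
  "horner h t p = fold_coeffs (\<lambda>c a. h c + a * t) p 0"

lemma horner_0 [simp]: "horner h t 0 = 0"
  by (simp add: horner_def)

lemma horner_pCons: "h 0 = 0 \<Longrightarrow> horner h t (pCons c p) = h c + horner h t p * t"
  by (cases "c = 0"; cases "p = 0") (simp_all add: horner_def)

lemma horner_add:
  assumes "h 0 = 0" "\<And>c d. h (c + d) = h c + h d"
  shows "horner h t (p + q) = horner h t p + horner h t q"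
  by (induction p q rule: poly_induct2) (simp_all add: horner_pCons assms algebra_simps)

locale scaled_algebra = vector_space scale
  for scale :: "'k::field \<Rightarrow> 'a::ring_1 \<Rightarrow> 'a" (infixr \<open>*s\<close> 75) +
  assumes mult_scale_left [algebra_simps]: "(c *s a) * b = c *s (a * b)"
    and mult_scale_right [algebra_simps]: "a * (c *s b) = c *s (a * b)"
locale right_ideal = scaled_algebra scale
  for scale :: "'k::field \<Rightarrow> 'a::ring_1 \<Rightarrow> 'a" (infixr \<open>*s\<close> 75) +
  fixes J :: "'a set"
  assumes zero_mem: "0 \<in> J"
    and diff_mem: "a \<in> J \<Longrightarrow> b \<in> J \<Longrightarrow> a - b \<in> J"
    and mult_mem: "a \<in> J \<Longrightarrow> a * r \<in> J"
begin

text \<open>\<open>a \<approx>\<^sub>J b\<close> says that \<open>a\<close> and \<open>b\<close> represent the same element of the right module of cosets of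
  \<open>J\<close>, and \<open>a \<doteq> b\<close> says that they act in the same way on it.\<close>

definition rcong :: "'a \<Rightarrow> 'a \<Rightarrow> bool" (infix \<open>\<approx>\<^sub>J\<close> 50) where
  "a \<approx>\<^sub>J b \<longleftrightarrow> a - b \<in> J"

definition acong :: "'a \<Rightarrow> 'a \<Rightarrow> bool" (infix \<open>\<doteq>\<close> 50) where
  "a \<doteq> b \<longleftrightarrow> (\<forall>u. u * a \<approx>\<^sub>J u * b)"

lemma uminus_mem: "a \<in> J \<Longrightarrow> - a \<in> J"
  using diff_mem[OF zero_mem] by simp

lemma add_mem: "a \<in> J \<Longrightarrow> b \<in> J \<Longrightarrow> a + b \<in> J"
  using diff_mem[OF _ uminus_mem] by fastforce

lemma scale_mem: "a \<in> J \<Longrightarrow> c *s a \<in> J"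
  using mult_mem[of a "c *s 1"] by (simp add: mult_scale_right)

lemma scale_mem_iff: "c \<noteq> 0 \<Longrightarrow> c *s a \<in> J \<longleftrightarrow> a \<in> J"
  using scale_mem[of "c *s a" "inverse c"] scale_mem[of a c] by auto

lemma rcong_refl [simp]: "a \<approx>\<^sub>J a"
  by (simp add: rcong_def zero_mem)

lemma rcong_sym: "a \<approx>\<^sub>J b \<Longrightarrow> b \<approx>\<^sub>J a"
  unfolding rcong_def using uminus_mem[of "a - b"] by simp

lemma rcong_trans [trans]: "a \<approx>\<^sub>J b \<Longrightarrow> b \<approx>\<^sub>J c \<Longrightarrow> a \<approx>\<^sub>J c"
  unfolding rcong_def using add_mem[of "a - b" "b - c"] by simp

lemma rcong_add: "a \<approx>\<^sub>J b \<Longrightarrow> c \<approx>\<^sub>J d \<Longrightarrow> a + c \<approx>\<^sub>J b + d"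
  unfolding rcong_def using add_mem[of "a - b" "c - d"] by (simp add: algebra_simps)

lemma rcong_diff: "a \<approx>\<^sub>J b \<Longrightarrow> c \<approx>\<^sub>J d \<Longrightarrow> a - c \<approx>\<^sub>J b - d"
  unfolding rcong_def using diff_mem[of "a - b" "c - d"] by (simp add: algebra_simps)

lemma rcong_mult: "a \<approx>\<^sub>J b \<Longrightarrow> a * r \<approx>\<^sub>J b * r"
  unfolding rcong_def using mult_mem[of "a - b" r] by (simp add: algebra_simps)

lemma rcong_scale: "a \<approx>\<^sub>J b \<Longrightarrow> c *s a \<approx>\<^sub>J c *s b"
  unfolding rcong_def using scale_mem[of "a - b" c] by (simp add: algebra_simps)

lemma rcong_sum: "(\<And>i. i \<in> S \<Longrightarrow> f i \<approx>\<^sub>J g i) \<Longrightarrow> sum f S \<approx>\<^sub>J sum g S"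
  by (induction S rule: infinite_finite_induct) (auto intro: rcong_add)

lemma rcong_mem_iff: "a \<approx>\<^sub>J b \<Longrightarrow> a \<in> J \<longleftrightarrow> b \<in> J"
  unfolding rcong_def using add_mem[of "a - b" b] diff_mem[of a "a - b"] by auto

lemma rcong_0_iff: "a \<approx>\<^sub>J 0 \<longleftrightarrow> a \<in> J"
  by (simp add: rcong_def)

lemma acong_refl [simp]: "a \<doteq> a"
  by (simp add: acong_def)

lemma acong_sym: "a \<doteq> b \<Longrightarrow> b \<doteq> a"
  by (auto simp: acong_def intro: rcong_sym)

lemma acong_trans [trans]: "a \<doteq> b \<Longrightarrow> b \<doteq> c \<Longrightarrow> a \<doteq> c"
  unfolding acong_def by (blast intro: rcong_trans)

lemma acong_add: "a \<doteq> b \<Longrightarrow> c \<doteq> d \<Longrightarrow> a + c \<doteq> b + d"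
  by (auto simp: acong_def distrib_left intro: rcong_add)

lemma acong_diff: "a \<doteq> b \<Longrightarrow> c \<doteq> d \<Longrightarrow> a - c \<doteq> b - d"
  by (auto simp: acong_def right_diff_distrib intro: rcong_diff)

lemma acong_scale: "a \<doteq> b \<Longrightarrow> c *s a \<doteq> c *s b"
  by (auto simp: acong_def mult_scale_right intro: rcong_scale)

text \<open>The first factor is exchanged by right multiplication, under which \<open>J\<close> is
  closed, the second by the quantifier over all left multipliers. So \<open>\<doteq>\<close> is a
  two-sided congruence, while \<open>\<approx>\<^sub>J\<close> is in general compatible with right
  multiplication only.\<close>

lemma acong_mult:
  assumes "a \<doteq> b" "c \<doteq> d"
  shows "a * c \<doteq> b * d"
  unfolding acong_def
proof
  fix u
  have "u * (a * c) \<approx>\<^sub>J u * b * c"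
    using rcong_mult assms(1) unfolding acong_def mult.assoc[symmetric] by blast
  also have "\<dots> \<approx>\<^sub>J u * b * d" using assms(2) by (simp add: acong_def)
  finally show "u * (a * c) \<approx>\<^sub>J u * (b * d)" by (simp add: mult.assoc)
qed

lemma acongD: "a \<doteq> b \<Longrightarrow> u * a \<approx>\<^sub>J u * b"
  by (simp add: acong_def)

lemma commute_horner:
  assumes h: "h 0 = 0" "\<And>c. s * h c \<doteq> h c * s" and t: "s * t \<doteq> t * s"
  shows "s * horner h t p \<doteq> horner h t p * s"
proof (induction p)
  case (pCons c p)
  have "s * horner h t p * t \<doteq> horner h t p * s * t"
    by (rule acong_mult[OF pCons.IH acong_refl])
  also have "\<dots> \<doteq> horner h t p * t * s"
    using acong_mult[OF acong_refl t] by (simp add: mult.assoc)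
  finally have "s * horner h t p * t \<doteq> horner h t p * t * s" .
  from acong_add[OF h(2)[of c] this] show ?case
    by (simp add: horner_pCons h(1) algebra_simps)
qed auto

text \<open>By \<open>commute_horner\<close>, \<open>t\<close> can be moved past the value of
  \<open>q\<close>. Multiplicativity of \<open>h\<close> and commutation with \<open>t\<close> are
  asked for modulo \<open>\<doteq>\<close>, because \<open>T\<close> and \<open>C\<close> are known
  to commute only in that sense.\<close>

lemma horner_mult:
  fixes h :: "'c::comm_semiring_0 \<Rightarrow> 'a"
  assumes h: "h 0 = 0" "\<And>c d. h (c + d) = h c + h d" "\<And>c d. h (c * d) \<doteq> h c * h d"
    and t: "\<And>c. t * h c \<doteq> h c * t"
  shows "horner h t (p * q) \<doteq> horner h t p * horner h t q"
proof (induction p)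
  case (pCons c p)
  have smult: "horner h t (smult c q) \<doteq> h c * horner h t q" for q
  proof (induction q)
    case (pCons d q)
    have "h (c * d) + horner h t (smult c q) * t \<doteq> h c * h d + h c * horner h t q * t"
      using pCons h(3) by (intro acong_add acong_mult) auto
    then show ?case by (simp add: horner_pCons h(1) algebra_simps)
  qed auto
  have "horner h t (p * q) * t \<doteq> horner h t p * horner h t q * t"
    using pCons by (intro acong_mult) auto
  also have "\<dots> \<doteq> horner h t p * (t * horner h t q)"
    unfolding mult.assoc
    by (intro acong_mult acong_refl acong_sym[OF commute_horner] h(1) t)
  finally have "horner h t (p * q) * t \<doteq> horner h t p * (t * horner h t q)" .
  from acong_add[OF smult this] show ?case
    by (simp add: horner_pCons horner_add[OF h(1,2)] h(1) algebra_simps)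
qed auto

text \<open>Moving \<open>w\<close> to the left past one factor \<open>a\<close> multiplies by
  \<open>r\<close> and leaves a scalar multiple of a lower power; these scalars add up to a
  geometric sum. At \<open>k = 0\<close> the truncated exponent \<open>k - 1\<close> is harmless
  because the sum is empty.\<close>

lemma commute_power_skew:
  assumes "a * w \<doteq> r *s (w * a) + s *s 1"
  shows "a ^ k * w \<doteq> r ^ k *s (w * a ^ k) + (s * (\<Sum>i<k. r ^ i)) *s a ^ (k - 1)"
proof (induction k)
  case (Suc k)
  have "a ^ Suc k * w = a * (a ^ k * w)" by (simp add: mult.assoc)
  also have "\<dots> \<doteq> a * (r ^ k *s (w * a ^ k) + (s * (\<Sum>i<k. r ^ i)) *s a ^ (k - 1))"
    by (intro acong_mult acong_refl Suc)
  also have "\<dots> = r ^ k *s (a * w * a ^ k) + (s * (\<Sum>i<k. r ^ i)) *s a ^ k"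
    by (cases k) (simp_all add: algebra_simps)
  also have "\<dots> \<doteq> r ^ k *s ((r *s (w * a) + s *s 1) * a ^ k) + (s * (\<Sum>i<k. r ^ i)) *s a ^ k"
    by (intro acong_mult acong_add acong_scale acong_refl assms)
  also have "\<dots> = r ^ Suc k *s (w * a ^ Suc k) + (s * (\<Sum>i<Suc k. r ^ i)) *s a ^ (Suc k - 1)"
    by (simp add: algebra_simps)
  finally show ?case .
qed simp

end

section \<open>The kernel of \<open>z\<close>\<close>

text \<open>\<open>J\<close> stands for the annihilator of a nonzero vector of the simple module and
  \<open>p\<close> for q^2. The relations hold up to \<open>\<doteq>\<close>, that is, as identities
  between actions on the cosets of \<open>J\<close>. Simplicity is stated for sets \<open>N\<close>
  closed under the three generators, so that only these have to be checked later.\<close>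

locale maximal_A_ideal = right_ideal scale J
  for scale :: "'k::alg_closed_field \<Rightarrow> 'a::ring_1 \<Rightarrow> 'a" (infixr \<open>*s\<close> 75) and J +
  fixes x y z :: 'a and p \<alpha> \<beta> \<gamma> :: 'k and l n :: nat
  assumes xy: "x * y \<doteq> p *s (y * x) + \<alpha> *s 1"
    and xz: "x * z \<doteq> inverse p *s (z * x) + \<beta> *s 1"
    and yz: "y * z \<doteq> p *s (z * y) + \<gamma> *s 1"
    and \<beta>: "\<beta> \<noteq> 0"
    and root: "primitive_root_of_unity l p" and l: "l > 1"
    and proper: "1 \<notin> J"
    and irreducible: "J \<subseteq> N \<Longrightarrow> (\<And>a b. a \<in> N \<Longrightarrow> b \<in> N \<Longrightarrow> a - b \<in> N) \<Longrightarrow>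
      (\<And>c a. a \<in> N \<Longrightarrow> c *s a \<in> N) \<Longrightarrow> (\<And>g a. g \<in> {x, y, z} \<Longrightarrow> a \<in> N \<Longrightarrow> a * g \<in> N) \<Longrightarrow>
      a \<in> N \<Longrightarrow> a \<notin> J \<Longrightarrow> b \<in> N"
    and nilpotent: "u * z ^ n \<in> J"
begin

section \<open>Quantum integers and commutation of powers of \<open>x\<close> with \<open>y\<close>
  and \<open>z\<close>\<close>

lemma power_l: "p ^ l = 1"
  and power_neq_1: "0 < k \<Longrightarrow> k < l \<Longrightarrow> p ^ k \<noteq> 1"
  using root by (auto simp: primitive_root_of_unity_def)

lemma p_nonzero: "p \<noteq> 0" and p_neq_1: "p \<noteq> 1"
  using power_l power_neq_1[of 1] l by (auto simp: power_0_left)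

definition qint :: "'k \<Rightarrow> nat \<Rightarrow> 'k" where
  "qint r k = (\<Sum>i<k. r ^ i)"

lemma qint_0 [simp]: "qint r 0 = 0"
  by (simp add: qint_def)

lemma qint_eq: "r \<noteq> 1 \<Longrightarrow> qint r k = (1 - r ^ k) / (1 - r)"
  by (simp add: qint_def sum_gp_strict)

text \<open>The inverse of \<open>p\<close> has the same order \<open>l\<close>. These are the
  factors that appear when \<open>z\<close> lowers an exponent, and they have to be
  cancelled.\<close>

lemma qint_inverse_nonzero: "0 < k \<Longrightarrow> k < l \<Longrightarrow> qint (inverse p) k \<noteq> 0"
  using power_neq_1[of k] p_neq_1 p_nonzero by (subst qint_eq) (auto simp: field_simps)

lemma power_x_y: "x ^ k * y \<doteq> p ^ k *s (y * x ^ k) + (\<alpha> * qint p k) *s x ^ (k - 1)"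
  unfolding qint_def by (rule commute_power_skew[OF xy])

lemma power_x_z:
  "x ^ k * z \<doteq> inverse p ^ k *s (z * x ^ k) + (\<beta> * qint (inverse p) k) *s x ^ (k - 1)"
  unfolding qint_def by (rule commute_power_skew[OF xz])

section \<open>The operators \<open>C\<close> and \<open>T\<close> and the kernel of
  \<open>z\<close>\<close>

abbreviation "C \<equiv> x ^ l"

text \<open>The coefficients make the constants \<gamma>\<beta> and \<beta>\<gamma> from the
  relations for xz and yz cancel. Then \<open>T * z\<close> acts like \<open>z\<close> followed by a
  combination of \<open>x\<close> and \<open>y\<close>, which is why \<open>T\<close> preserves the
  kernel of \<open>z\<close>.\<close>

definition "T = \<gamma> *s x - \<beta> *s y"

text \<open>The kernel of \<open>z\<close> on the cosets of \<open>J\<close>, taken as a set of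
  representatives; hence it contains \<open>J\<close>.\<close>

definition "V = {u. u * z \<in> J}"

text \<open>At exponent \<open>l\<close> the factor \<open>p ^ l\<close> is 1 and the quantum
  integer vanishes, so only the commuting term survives.\<close>

lemma C_y: "C * y \<doteq> y * C"
  using power_x_y[of l] by (simp add: power_l qint_eq p_neq_1)

lemma C_z: "C * z \<doteq> z * C"
  using power_x_z[of l] p_neq_1 by (simp add: power_l power_inverse qint_eq)

lemma C_T: "C * T \<doteq> T * C"
proof -
  have "\<gamma> *s (x * C) - \<beta> *s (C * y) \<doteq> \<gamma> *s (x * C) - \<beta> *s (y * C)"
    by (intro acong_diff acong_scale acong_refl C_y)
  then show ?thesis by (simp add: T_def algebra_simps power_commutes)
qed

lemma J_subset_V: "J \<subseteq> V"
  by (auto simp: V_def mult_mem)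

lemma V_diff: "a \<in> V \<Longrightarrow> b \<in> V \<Longrightarrow> a - b \<in> V"
  by (simp add: V_def algebra_simps diff_mem)

lemma V_scale: "a \<in> V \<Longrightarrow> c *s a \<in> V"
  by (simp add: V_def algebra_simps scale_mem)

lemma V_C: "u \<in> V \<Longrightarrow> u * C \<in> V"
  using acongD[OF C_z, of u] mult_mem[of "u * z" C] rcong_mem_iff
  by (simp add: V_def mult.assoc)

lemma V_T:
  assumes "u \<in> V"
  shows "u * T \<in> V"
proof -
  have "T * z = \<gamma> *s (x * z) - \<beta> *s (y * z)"
    by (simp add: T_def algebra_simps)
  also have "\<dots> \<doteq> \<gamma> *s (inverse p *s (z * x) + \<beta> *s 1) - \<beta> *s (p *s (z * y) + \<gamma> *s 1)"
    by (intro acong_diff acong_scale xz yz)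
  also have "\<dots> = z * ((\<gamma> * inverse p) *s x - (\<beta> * p) *s y)"
    by (simp add: algebra_simps)
  finally have "u * (T * z) \<approx>\<^sub>J u * z * ((\<gamma> * inverse p) *s x - (\<beta> * p) *s y)"
    by (metis acongD mult.assoc)
  moreover have "u * z * ((\<gamma> * inverse p) *s x - (\<beta> * p) *s y) \<in> J"
    using assms by (auto simp: V_def intro: mult_mem)
  ultimately show ?thesis by (simp add: V_def rcong_mem_iff mult.assoc)
qed

text \<open>The summand with \<open>z * x ^ k\<close> disappears modulo \<open>J\<close> because
  \<open>w * z\<close> lies in \<open>J\<close>.\<close>

lemma V_power_x_z:
  assumes "w \<in> V"
  shows "w * x ^ k * z \<approx>\<^sub>J (\<beta> * qint (inverse p) k) *s (w * x ^ (k - 1))"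
proof -
  have "w * x ^ k * z \<approx>\<^sub>J
      w * z * (inverse p ^ k *s x ^ k) + (\<beta> * qint (inverse p) k) *s (w * x ^ (k - 1))"
    using acongD[OF power_x_z, of w k] by (simp add: algebra_simps)
  also have "\<dots> \<approx>\<^sub>J 0 + (\<beta> * qint (inverse p) k) *s (w * x ^ (k - 1))"
    using assms by (intro rcong_add) (auto simp: V_def rcong_0_iff intro: mult_mem)
  finally show ?thesis by simp
qed

text \<open>Since \<beta> is nonzero, \<open>y\<close> can be eliminated in favour of
  \<open>x\<close> and \<open>T\<close>. Once \<open>T\<close> acts by a scalar, this is the shape
  of \<open>M4_y\<close>.\<close>

lemma mult_power_x_y:
  "w * x ^ k * y \<approx>\<^sub>J (p ^ k * \<gamma> * inverse \<beta>) *s (w * x ^ (k + 1))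
     - (p ^ k * inverse \<beta>) *s (w * T * x ^ k) + (\<alpha> * qint p k) *s (w * x ^ (k - 1))"
proof -
  have "y = inverse \<beta> *s (\<gamma> *s x - T)"
    using \<beta> by (simp add: T_def)
  then have "w * (y * x ^ k) = w * (inverse \<beta> *s (\<gamma> *s x - T) * x ^ k)"
    by simp
  also have "\<dots> = (inverse \<beta> * \<gamma>) *s (w * (x * x ^ k)) - inverse \<beta> *s (w * T * x ^ k)"
    by (simp add: algebra_simps)
  finally have y: "w * (y * x ^ k) =
      (inverse \<beta> * \<gamma>) *s (w * (x * x ^ k)) - inverse \<beta> *s (w * T * x ^ k)" .
  have "w * x ^ k * y \<approx>\<^sub>J p ^ k *s (w * (y * x ^ k)) + (\<alpha> * qint p k) *s (w * x ^ (k - 1))"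
    using acongD[OF power_x_y, of w k] by (simp add: algebra_simps)
  then show ?thesis unfolding y by (simp add: algebra_simps)
qed

text \<open>Right multiplication by \<open>z\<close> lowers the exponents and kills the constant term.\<close>

lemma V_independent:
  assumes "m \<le> l" "\<And>k. k < m \<Longrightarrow> w k \<in> V" "(\<Sum>k<m. w k * x ^ k) \<in> J" "k < m"
  shows "w k \<in> J"
  using assms
proof (induction m arbitrary: w k)
  case (Suc m)
  \<comment> \<open>The coefficients after multiplication by \<open>z\<close>, shifted by one index;
    the former term of index 0 drops out because \<open>qint r 0\<close> is 0.\<close>
  let ?w' = "\<lambda>k. (\<beta> * qint (inverse p) (Suc k)) *s w (Suc k)"
  have "(\<Sum>k<Suc m. w k * x ^ k) * z = (\<Sum>k<Suc m. w k * x ^ k * z)"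
    by (rule sum_distrib_right)
  also have "\<dots> \<approx>\<^sub>J (\<Sum>k<Suc m. (\<beta> * qint (inverse p) k) *s (w k * x ^ (k - 1)))"
    using Suc.prems(2) by (intro rcong_sum V_power_x_z) auto
  also have "\<dots> = (\<Sum>k<m. ?w' k * x ^ k)"
    by (subst sum.lessThan_Suc_shift) (simp add: mult_scale_left)
  finally have "(\<Sum>k<m. ?w' k * x ^ k) \<in> J"
    using mult_mem[OF Suc.prems(3), of z] by (simp add: rcong_mem_iff)
  moreover have "?w' k \<in> V" if "k < m" for k
    using Suc.prems(2)[of "Suc k"] that by (simp add: V_scale)
  ultimately have IH: "?w' k \<in> J" if "k < m" for k
    using Suc.IH[of ?w' k] Suc_leD[OF Suc.prems(1)] that by blast
  \<comment> \<open>As \<open>Suc k < l\<close>, both \<beta> and the quantum integer can be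
    cancelled.\<close>
  have pos: "w (Suc k) \<in> J" if "k < m" for k
    using that IH[OF that] Suc.prems(1) \<beta> qint_inverse_nonzero[of "Suc k"]
    by (simp add: scale_mem_iff)
  have "(\<Sum>k<m. w (Suc k) * x ^ Suc k) \<approx>\<^sub>J (\<Sum>k<m. 0)"
    using pos by (intro rcong_sum) (simp add: rcong_0_iff mult_mem)
  then have "(\<Sum>k<m. w (Suc k) * x ^ Suc k) \<in> J"
    by (simp add: rcong_0_iff)
  then have "w 0 \<in> J"
    using diff_mem[OF Suc.prems(3)] unfolding sum.lessThan_Suc_shift by fastforce
  then show ?case using pos Suc.prems(4) by (cases k) auto
qed simp

text \<open>The sums of the stated form are a subset \<open>N\<close> stable under the generators:
  \<open>x\<close> raises exponents and wraps around through \<open>C\<close>, \<open>z\<close>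
  lowers them, and \<open>y\<close> is expressed by \<open>x\<close> and \<open>T\<close>. As
  \<open>N\<close> contains \<open>a\<close> outside \<open>J\<close>, irreducibility makes it
  everything.\<close>

lemma V_spanning:
  assumes W: "J \<subseteq> W" "W \<subseteq> V" "\<And>a b. a \<in> W \<Longrightarrow> b \<in> W \<Longrightarrow> a - b \<in> W"
    "\<And>c a. a \<in> W \<Longrightarrow> c *s a \<in> W" "\<And>a. a \<in> W \<Longrightarrow> a * T \<in> W" "\<And>a. a \<in> W \<Longrightarrow> a * C \<in> W"
    and a: "a \<in> W" "a \<notin> J"
  obtains w where "\<And>k. w k \<in> W" "b \<approx>\<^sub>J (\<Sum>k<l. w k * x ^ k)"
proof -
  define N where "N = {b. \<exists>w. (\<forall>k. w k \<in> W) \<and> b \<approx>\<^sub>J (\<Sum>k<l. w k * x ^ k)}"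
  have zero_W: "0 \<in> W" using W(1) zero_mem by blast
  have cong_N: "b \<in> N" if "b \<approx>\<^sub>J c" "c \<in> N" for b c
    using that rcong_trans unfolding N_def by blast
  have J_N: "J \<subseteq> N"
    using zero_W unfolding N_def by (auto intro!: exI[of _ "\<lambda>_. 0"] simp: rcong_0_iff)
  have diff_N: "b - c \<in> N" if "b \<in> N" "c \<in> N" for b c
  proof -
    from that obtain v w where "\<forall>k. v k \<in> W" "b \<approx>\<^sub>J (\<Sum>k<l. v k * x ^ k)"
      "\<forall>k. w k \<in> W" "c \<approx>\<^sub>J (\<Sum>k<l. w k * x ^ k)"
      unfolding N_def by blast
    then show ?thesis
      using rcong_diff[of b _ c] W(3) unfolding N_def
      by (auto intro!: exI[of _ "\<lambda>k. v k - w k"] simp: left_diff_distrib sum_subtractf)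
  qed
  have add_N: "b + c \<in> N" if "b \<in> N" "c \<in> N" for b c
    using diff_N[OF that(1) diff_N[of 0 c]] J_N zero_mem that by auto
  have scale_N: "c *s b \<in> N" if "b \<in> N" for b c
  proof -
    from that obtain w where "\<forall>k. w k \<in> W" "b \<approx>\<^sub>J (\<Sum>k<l. w k * x ^ k)"
      unfolding N_def by blast
    then show ?thesis
      using rcong_scale[of b "\<Sum>k<l. w k * x ^ k" c] W(4) unfolding N_def
      by (auto intro!: exI[of _ "\<lambda>k. c *s w k"] simp: mult_scale_left scale_sum_right)
  qed
  have single_N: "w * x ^ k \<in> N" if "w \<in> W" "k < l" for w k
  proof -
    have "(\<Sum>i<l. (if i = k then w else 0) * x ^ i) = (\<Sum>i<l. if i = k then w * x ^ i else 0)"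
      by (intro sum.cong) auto
    then show ?thesis
      using that zero_W unfolding N_def
      by (auto intro!: exI[of _ "\<lambda>i. if i = k then w else 0"])
  qed
  \<comment> \<open>At the top exponent, \<open>w * x ^ l\<close> is \<open>w * C\<close>, which is
    again a term with exponent 0.\<close>
  have next_N: "w * x ^ (k + 1) \<in> N" if "w \<in> W" "k < l" for w k
  proof (cases "k + 1 = l")
    case True
    then show ?thesis using single_N[of "w * C" 0] that W(6) l by simp
  next
    case False
    then show ?thesis using single_N[OF that(1), of "k + 1"] that(2) by simp
  qed
  have gen_N: "w * x ^ k * g \<in> N" if "w \<in> W" "k < l" "g \<in> {x, y, z}" for w k g
  proof -
    have pred: "w * x ^ (k - 1) \<in> N" using single_N that by simp
    have "w * x ^ k * x \<in> N" using next_N[OF that(1,2)] by (simp add: mult.assoc power_commutes)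
    moreover have "w * x ^ k * z \<in> N"
      by (rule cong_N[OF V_power_x_z]) (use pred scale_N that(1) W(2) in auto)
    moreover have "w * x ^ k * y \<in> N"
      by (rule cong_N[OF mult_power_x_y])
        (use pred next_N[OF that(1,2)] single_N[OF W(5)[OF that(1)] that(2)] in
          \<open>auto intro!: add_N diff_N scale_N\<close>)
    ultimately show ?thesis using that(3) by auto
  qed
  have "b \<in> N"
  proof (rule irreducible[of N a])
    show "c * g \<in> N" if g: "g \<in> {x, y, z}" and c: "c \<in> N" for g c
    proof -
      from c obtain w where w: "\<forall>k. w k \<in> W" "c \<approx>\<^sub>J (\<Sum>k<l. w k * x ^ k)"
        unfolding N_def by blast
      have "(\<Sum>k\<in>S. w k * x ^ k * g) \<in> N" if "S \<subseteq> {..<l}" for S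
        using that by (induction S rule: infinite_finite_induct)
          (use J_N zero_mem w(1) g in \<open>auto intro!: add_N gen_N\<close>)
      then have "(\<Sum>k<l. w k * x ^ k) * g \<in> N"
        by (simp add: sum_distrib_right)
      then show ?thesis using cong_N rcong_mult[OF w(2)] by blast
    qed
    show "a \<in> N" using single_N[of a 0] a l by simp
  qed (use J_N diff_N scale_N a in auto)
  then show ?thesis using that unfolding N_def by blast
qed

text \<open>Expand \<open>b\<close> with coefficients in \<open>W\<close>. Both sides have all
  coefficients in \<open>V\<close>, so by independence \<open>b\<close> agrees modulo
  \<open>J\<close> with the coefficient of exponent 0, which lies in \<open>W\<close>.\<close>

lemma V_irreducible:
  assumes W: "J \<subseteq> W" "W \<subseteq> V" "\<And>a b. a \<in> W \<Longrightarrow> b \<in> W \<Longrightarrow> a - b \<in> W"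
    "\<And>c a. a \<in> W \<Longrightarrow> c *s a \<in> W" "\<And>a. a \<in> W \<Longrightarrow> a * T \<in> W" "\<And>a. a \<in> W \<Longrightarrow> a * C \<in> W"
    and a: "a \<in> W" "a \<notin> J" and b: "b \<in> V"
  shows "b \<in> W"
proof -
  obtain w where w: "\<And>k. w k \<in> W" "b \<approx>\<^sub>J (\<Sum>k<l. w k * x ^ k)"
    using V_spanning[OF W a] by blast
  have "{..<l} = insert 0 {0<..<l}" using l by auto
  then have split: "(\<Sum>k<l. f k) = f 0 + (\<Sum>k\<in>{0<..<l}. f k)" for f :: "nat \<Rightarrow> 'a"
    by simp
  let ?w = "\<lambda>k. if k = 0 then b - w 0 else - w k"
  have neg: "- c \<in> V" if "c \<in> V" for c
    using V_diff[of 0 c] that J_subset_V zero_mem by auto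
  have "(\<Sum>k<l. ?w k * x ^ k) = b - (\<Sum>k<l. w k * x ^ k)"
    unfolding split by (simp add: sum_negf)
  then have "(\<Sum>k<l. ?w k * x ^ k) \<in> J"
    using w(2) by (simp add: rcong_def)
  moreover have "?w k \<in> V" for k
    using w(1) W(2) b by (auto intro: V_diff neg)
  ultimately have "?w 0 \<in> J"
    using V_independent[of l ?w 0] l by blast
  then have "b - w 0 \<in> W" using W(1) by auto
  moreover have "0 - w 0 \<in> W"
    using W(1) zero_mem by (intro W(3) w(1)) blast
  ultimately have "(b - w 0) - (0 - w 0) \<in> W"
    by (rule W(3))
  then show ?thesis by simp
qed

section \<open>Evaluation of polynomials in two variables at \<open>T\<close> and
  \<open>C\<close>\<close>

definition ev :: "'k poly poly \<Rightarrow> 'a" where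
  "ev = horner (horner (\<lambda>c. c *s 1) T) C"

lemma ev_pCons: "ev (pCons f P) = horner (\<lambda>c. c *s 1) T f + ev P * C"
  by (simp add: ev_def horner_pCons)

lemma ev_0 [simp]: "ev 0 = 0"
  by (simp add: ev_def)

lemma ev_const: "ev [:[:c:]:] = c *s 1"
  by (simp add: ev_pCons horner_pCons)

lemma ev_1 [simp]: "ev 1 = 1"
  using ev_const[of 1] by (simp flip: one_pCons)

lemma ev_t: "ev [:[:c, 1:]:] = c *s 1 + T"
  by (simp add: ev_pCons horner_pCons)

lemma ev_x: "ev [:[:c:], 1:] = c *s 1 + C"
  by (simp add: ev_pCons horner_pCons one_pCons)

lemma ev_add: "ev (P + Q) = ev P + ev Q"
  unfolding ev_def by (intro horner_add) (simp_all add: scale_left_distrib)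

lemma ev_mult: "ev (P * Q) \<doteq> ev P * ev Q"
proof -
  have "horner (\<lambda>c. c *s 1) T (f * g) \<doteq> horner (\<lambda>c. c *s 1) T f * horner (\<lambda>c. c *s 1) T g" for f g
    by (intro horner_mult) (simp_all add: algebra_simps)
  moreover have "C * horner (\<lambda>c. c *s 1) T f \<doteq> horner (\<lambda>c. c *s 1) T f * C" for f
    by (intro commute_horner C_T) (simp_all add: algebra_simps)
  ultimately show ?thesis
    unfolding ev_def by (intro horner_mult horner_add) (simp_all add: algebra_simps)
qed

lemma ev_diff: "ev (P - Q) = ev P - ev Q"
  using ev_add[of "P - Q" Q] by (simp add: algebra_simps)

lemma ev_mult_rcong: "u * ev P * ev Q \<approx>\<^sub>J u * ev (P * Q)"
  using acongD[OF acong_sym[OF ev_mult]] by (simp add: mult.assoc)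

lemma V_ev: "u \<in> V \<Longrightarrow> u * ev P \<in> V"
proof (induction P)
  case 0
  then show ?case using J_subset_V zero_mem by auto
next
  case (pCons f P)
  have V_add: "a + b \<in> V" if "a \<in> V" "b \<in> V" for a b
    using that by (simp add: V_def algebra_simps add_mem)
  have "u * horner (\<lambda>c. c *s 1) T f \<in> V"
  proof (induction f)
    case 0
    then show ?case using J_subset_V zero_mem by auto
  next
    case (pCons c f)
    then show ?case using \<open>u \<in> V\<close> V_T
      by (auto simp: horner_pCons distrib_left mult_scale_right simp flip: mult.assoc
          intro!: V_add V_scale)
  qed
  then show ?case using pCons V_C
    by (auto simp: ev_pCons distrib_left simp flip: mult.assoc intro!: V_add)
qed

text \<open>\<open>V\<close> is irreducible under \<open>T\<close> and \<open>C\<close>, so the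
  polynomials annihilating an element of \<open>V\<close> outside \<open>J\<close> form a maximal
  ideal. The point provided by the Nullstellensatz consists of the two eigenvalues.\<close>

lemma ex_eigenvector:
  obtains v \<tau> \<mu> where "v \<in> V" "v \<notin> J" "v * T \<approx>\<^sub>J \<tau> *s v" "v * C \<approx>\<^sub>J \<mu> *s v"
proof -
  have "\<exists>n. z ^ n \<in> J" using nilpotent[of 1] by auto
  \<comment> \<open>For the least such \<open>m\<close>, the power of exponent \<open>m - 1\<close>
    is killed by \<open>z\<close> modulo \<open>J\<close> without lying in \<open>J\<close>;
    \<open>m\<close> is positive because 1 is outside \<open>J\<close>.\<close>
  then obtain m where m: "z ^ m \<in> J" and least: "\<And>i. i < m \<Longrightarrow> z ^ i \<notin> J"
    using exists_least_iff[of "\<lambda>n. z ^ n \<in> J"] by blast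
  have "m > 0" using m proper by (cases m) auto
  define u where "u = z ^ (m - 1)"
  have u: "u \<in> V" "u \<notin> J"
    using m least[of "m - 1"] \<open>m > 0\<close> by (auto simp: u_def V_def simp flip: power_Suc2)
  define I where "I = {P. u * ev P \<in> J}"
  have "\<exists>a b. [:[:-a, 1:]:] \<in> I \<and> [:[:-b:], 1:] \<in> I"
  proof (rule weak_nullstellensatz_two_variables)
    show "1 \<notin> I" using u by (simp add: I_def)
    show "P + Q \<in> I" if "P \<in> I" "Q \<in> I" for P Q
      using that by (simp add: I_def ev_add distrib_left add_mem)
    show "P * Q \<in> I" if "P \<in> I" for P Q
      using that ev_mult_rcong[of u P Q] mult_mem[of "u * ev P" "ev Q"]
      by (simp add: I_def rcong_mem_iff)
    show "\<exists>Q. P * Q - 1 \<in> I" if "P \<notin> I" for P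
    proof -
      \<comment> \<open>The subspace generated by \<open>u * ev P\<close> under \<open>T\<close> and
        \<open>C\<close>. By irreducibility it contains \<open>u\<close>, and this yields the
        inverse \<open>Q\<close> of \<open>P\<close> modulo \<open>I\<close>.\<close>
      define W where "W = {w. \<exists>Q. w \<approx>\<^sub>J u * ev (P * Q)}"
      have W_ev: "w * ev R \<in> W" if "w \<in> W" for w R
      proof -
        from that obtain Q where "w \<approx>\<^sub>J u * ev (P * Q)" unfolding W_def by blast
        from rcong_trans[OF rcong_mult[OF this] ev_mult_rcong]
        show ?thesis unfolding W_def by (auto simp: mult.assoc)
      qed
      have "u \<in> W"
      proof (rule V_irreducible[of W "u * ev P"])
        show "J \<subseteq> W" by (auto simp: W_def rcong_0_iff intro!: exI[of _ 0])
        show "W \<subseteq> V"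
        proof
          fix w assume "w \<in> W"
          then obtain Q where "w - u * ev (P * Q) \<in> J" unfolding W_def rcong_def by blast
          moreover have "0 - u * ev (P * Q) \<in> V"
            using J_subset_V zero_mem by (intro V_diff V_ev u(1)) blast
          ultimately have "w - u * ev (P * Q) - (0 - u * ev (P * Q)) \<in> V"
            using J_subset_V by (blast intro: V_diff)
          then show "w \<in> V" by simp
        qed
        show "a - b \<in> W" if "a \<in> W" "b \<in> W" for a b
        proof -
          from that obtain Q R where "a \<approx>\<^sub>J u * ev (P * Q)" "b \<approx>\<^sub>J u * ev (P * R)"
            unfolding W_def by blast
          from rcong_diff[OF this] show ?thesis
            unfolding W_def by (auto intro!: exI[of _ "Q - R"] simp: algebra_simps ev_diff)
        qed
        show "c *s a \<in> W" if "a \<in> W" for c a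
          using W_ev[OF that, of "[:[:c:]:]"] by (simp add: ev_const mult_scale_right)
        show "a * T \<in> W" if "a \<in> W" for a
          using W_ev[OF that, of "[:[:0, 1:]:]"] by (simp add: ev_t)
        show "a * C \<in> W" if "a \<in> W" for a
          using W_ev[OF that, of "[:[:0:], 1:]"] ev_x[of 0] by simp
        show "u * ev P \<in> W" unfolding W_def by (auto intro!: exI[of _ 1])
        show "u * ev P \<notin> J" using that by (simp add: I_def)
      qed (rule u)
      then obtain Q where "u \<approx>\<^sub>J u * ev (P * Q)" unfolding W_def by blast
      then have "u * ev (P * Q) - u \<in> J" using rcong_sym unfolding rcong_def by blast
      then show ?thesis
        by (auto simp: I_def ev_diff right_diff_distrib)
    qed
  qed
  then obtain a b where "u * ev [:[:-a, 1:]:] \<in> J" "u * ev [:[:-b:], 1:] \<in> J"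
    unfolding I_def by blast
  then have "u * T - a *s u \<in> J" "u * C - b *s u \<in> J"
    by (simp_all add: ev_t ev_x algebra_simps)
  then show ?thesis
    using that u unfolding rcong_def by blast
qed

end

section \<open>Comparison with \<open>M\<^sub>4(\<mu>\<^sub>1, \<mu>\<^sub>2)\<close>\<close>

lemma lookup_vscale [simp]: "Poly_Mapping.lookup (vscale c v) k = c * Poly_Mapping.lookup v k"
  by (simp add: vscale_def Poly_Mapping.map.rep_eq when_def)

lemma keys_vscale: "Poly_Mapping.keys (vscale c v) \<subseteq> Poly_Mapping.keys v"
  by (auto simp: in_keys_iff)

lemma keys_linear_ext:
  assumes "\<And>k. k \<in> Poly_Mapping.keys v \<Longrightarrow> Poly_Mapping.keys (f k) \<subseteq> S"
  shows "Poly_Mapping.keys (linear_ext f v) \<subseteq> S"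
  unfolding linear_ext_def
  by (rule order_trans[OF Poly_Mapping.keys_sum]) (use assms keys_vscale in fastforce)

lemma keys_vbasis [simp]: "Poly_Mapping.keys (vbasis k :: nat \<Rightarrow>\<^sub>0 'k::field) = {k}"
  by (simp add: vbasis_def)

lemma keys_M4_gen:
  assumes "l > 1" "Poly_Mapping.keys w \<subseteq> {..<l}"
  shows "Poly_Mapping.keys (M4_gen l q \<alpha> \<beta> \<gamma> \<mu>1 \<mu>2 g w) \<subseteq> {..<l}"
proof -
  have keys_scaled: "Poly_Mapping.keys (vscale c (vbasis k)) \<subseteq> {..<l}" if "k < l" for c :: 'a and k
    using keys_vscale[of c "vbasis k"] that by auto
  have keys_add: "Poly_Mapping.keys (u + v) \<subseteq> {..<l}"
    and keys_diff: "Poly_Mapping.keys (u - v) \<subseteq> {..<l}"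
    if "Poly_Mapping.keys u \<subseteq> {..<l}" "Poly_Mapping.keys v \<subseteq> {..<l}"
    for u v :: "nat \<Rightarrow>\<^sub>0 'a"
    using that Poly_Mapping.keys_add[of u v] keys_diff[of u v] by auto
  have "Poly_Mapping.keys (case g of GX \<Rightarrow> M4_x l \<mu>1 k | GY \<Rightarrow> M4_y l q \<alpha> \<beta> \<gamma> \<mu>1 \<mu>2 k
      | GZ \<Rightarrow> M4_z q \<beta> k) \<subseteq> {..<l}" if "k < l" for k
    using that \<open>l > 1\<close>
    by (cases g) (auto simp: M4_x_def M4_y_def M4_z_def keys_add keys_diff keys_scaled)
  then show ?thesis
    unfolding M4_gen_def using assms(2) by (intro keys_linear_ext) (cases g; auto)
qed

context maximal_A_ideal
begin

text \<open>The candidate isomorphism before passing to cosets of \<open>J\<close>: the basis vector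
  m_k goes to \<open>v * x ^ k\<close>.\<close>

definition phi :: "'a \<Rightarrow> (nat \<Rightarrow>\<^sub>0 'k) \<Rightarrow> 'a" where
  "phi v w = (\<Sum>k<l. Poly_Mapping.lookup w k *s (v * x ^ k))"

lemma phi_0 [simp]: "phi v 0 = 0"
  by (simp add: phi_def)

lemma phi_add: "phi v (w + w') = phi v w + phi v w'"
  by (simp add: phi_def lookup_add scale_left_distrib sum.distrib)

lemma phi_diff: "phi v (w - w') = phi v w - phi v w'"
  by (simp add: phi_def lookup_minus scale_left_diff_distrib sum_subtractf)

lemma phi_vscale: "phi v (vscale c w) = c *s phi v w"
  by (simp add: phi_def scale_sum_right)

lemma phi_sum: "phi v (sum f S) = (\<Sum>i\<in>S. phi v (f i))"
  by (induction S rule: infinite_finite_induct) (simp_all add: phi_add)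

lemma phi_vbasis: "k < l \<Longrightarrow> phi v (vbasis k) = v * x ^ k"
  by (simp add: phi_def vbasis_def lookup_single when_def if_distrib[of "\<lambda>c. c *s _"] cong: if_cong)

lemma phi_keys:
  "Poly_Mapping.keys w \<subseteq> {..<l} \<Longrightarrow>
    phi v w = (\<Sum>k\<in>Poly_Mapping.keys w. Poly_Mapping.lookup w k *s (v * x ^ k))"
  unfolding phi_def by (rule sum.mono_neutral_right) (auto simp: in_keys_iff)

text \<open>The scalar multiples of \<open>v\<close> lie in \<open>V\<close>, so independence puts
  each of them into \<open>J\<close>; as \<open>v\<close> is outside \<open>J\<close>, the scalars
  vanish.\<close>

lemma phi_eq_0:
  assumes "v \<in> V" "v \<notin> J" "Poly_Mapping.keys w \<subseteq> {..<l}" "phi v w \<in> J"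
  shows "w = 0"
proof (rule poly_mapping_eqI)
  fix k
  show "Poly_Mapping.lookup w k = Poly_Mapping.lookup 0 k"
  proof (cases "k < l")
    case True
    have "Poly_Mapping.lookup w k *s v \<in> J"
      using assms True by (intro V_independent[of l "\<lambda>k. Poly_Mapping.lookup w k *s v" k])
        (auto simp: phi_def mult_scale_left V_scale)
    then show ?thesis using assms(2) scale_mem_iff by auto
  next
    case False
    then show ?thesis using assms(3) by (auto simp: in_keys_iff)
  qed
qed

end

locale maximal_A_ideal_eigenvector = maximal_A_ideal +
  fixes v and \<tau> \<mu>
  assumes v: "v \<in> V" "v \<notin> J" and v_T: "v * T \<approx>\<^sub>J \<tau> *s v" and v_C: "v * C \<approx>\<^sub>J \<mu> *s v"
begin

text \<open>The multiples of \<open>v\<close> modulo \<open>J\<close> are stable under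
  \<open>T\<close> and \<open>C\<close> by the eigenvector equations, so they can serve as
  coefficients in \<open>V_spanning\<close>.\<close>

lemma phi_surj:
  obtains w where "Poly_Mapping.keys w \<subseteq> {..<l}" "b \<approx>\<^sub>J phi v w"
proof -
  define W where "W = {a. \<exists>c. a \<approx>\<^sub>J c *s v}"
  have scale_W: "c *s a \<in> W" if "a \<in> W" for c a
    using that rcong_scale[of a _ c] unfolding W_def by force
  have cong_W: "a \<in> W" if "a \<approx>\<^sub>J b" "b \<in> W" for a b
    using that rcong_trans unfolding W_def by blast
  have mult_W: "a * r \<in> W" if "a \<in> W" "v * r \<approx>\<^sub>J c *s v" for a r c
  proof -
    from that obtain d where "a \<approx>\<^sub>J d *s v" unfolding W_def by blast
    from rcong_trans[OF rcong_mult[OF this, of r]] rcong_scale[OF that(2), of d]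
    show ?thesis unfolding W_def by (auto simp: mult_scale_left)
  qed
  obtain f where f: "\<And>k. f k \<in> W" "b \<approx>\<^sub>J (\<Sum>k<l. f k * x ^ k)"
  proof (rule V_spanning[of W v b])
    show "J \<subseteq> W" by (auto simp: W_def rcong_0_iff intro!: exI[of _ 0])
    show "a - b \<in> W" if "a \<in> W" "b \<in> W" for a b
    proof -
      from that obtain c d where "a \<approx>\<^sub>J c *s v" "b \<approx>\<^sub>J d *s v" unfolding W_def by blast
      from rcong_diff[OF this] show ?thesis
        unfolding W_def by (auto intro!: exI[of _ "c - d"] simp: scale_left_diff_distrib)
    qed
    show "W \<subseteq> V"
    proof
      fix a assume "a \<in> W"
      then obtain c where "a \<approx>\<^sub>J c *s v" unfolding W_def by blast
      from rcong_mult[OF this, of z] show "a \<in> V"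
        using V_scale[OF v(1), of c] by (simp add: V_def rcong_mem_iff)
    qed
    show "v \<in> W" by (auto simp: W_def intro!: exI[of _ 1])
  qed (use scale_W mult_W v_T v_C v in auto)
  from f(1) obtain c where c: "\<And>k. f k \<approx>\<^sub>J c k *s v" unfolding W_def by (auto intro: choice) metis
  define w where "w = (\<Sum>k<l. Poly_Mapping.single k (c k))"
  have w: "Poly_Mapping.lookup w k = (if k < l then c k else 0)" for k
    by (simp add: w_def lookup_sum lookup_single when_def)
  have "(\<Sum>k<l. f k * x ^ k) \<approx>\<^sub>J (\<Sum>k<l. c k *s v * x ^ k)"
    by (intro rcong_sum rcong_mult c)
  also have "\<dots> = phi v w"
    by (simp add: phi_def w mult_scale_left)
  finally have "b \<approx>\<^sub>J phi v w" using f(2) rcong_trans by blast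
  moreover have "Poly_Mapping.keys w \<subseteq> {..<l}"
    by (auto simp: in_keys_iff w split: if_splits)
  ultimately show ?thesis using that by blast
qed

lemma v_power_x_y:
  "v * x ^ k * y \<approx>\<^sub>J (p ^ k * \<gamma> * inverse \<beta>) *s (v * x ^ (k + 1))
     - (p ^ k * inverse \<beta> * \<tau>) *s (v * x ^ k) + (\<alpha> * qint p k) *s (v * x ^ (k - 1))"
proof -
  have "v * T * x ^ k \<approx>\<^sub>J \<tau> *s v * x ^ k"
    by (rule rcong_mult[OF v_T])
  from rcong_scale[OF this, of "p ^ k * inverse \<beta>"]
  have "(p ^ k * inverse \<beta>) *s (v * T * x ^ k) \<approx>\<^sub>J (p ^ k * inverse \<beta> * \<tau>) *s (v * x ^ k)"
    by (simp add: mult_scale_left)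
  then show ?thesis
    by (intro rcong_trans[OF mult_power_x_y] rcong_add rcong_diff rcong_refl)
qed

lemma v_power_l: "v * x ^ (l - 1) * x \<approx>\<^sub>J \<mu> *s v"
  using v_C l by (simp add: mult.assoc flip: power_Suc2)

lemma phi_M4_x:
  assumes "k < l"
  shows "phi v (M4_x l \<mu> k) \<approx>\<^sub>J v * x ^ k * x"
  using assms v_power_l l phi_vbasis[of 0] phi_vbasis[of "k + 1"]
  by (auto simp: M4_x_def phi_vscale mult.assoc power_commutes intro: rcong_sym)

lemma phi_M4_y:
  assumes q: "p = q ^ 2" and "k < l" and \<tau>: "\<tau> = \<mu>2 * (q ^ 2 - 1)"
  shows "phi v (M4_y l q \<alpha> \<beta> \<gamma> \<mu> \<mu>2 k) \<approx>\<^sub>J v * x ^ k * y"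
proof -
  have p_power: "q ^ (2 * i) = p ^ i" for i
    by (simp add: q power_mult)
  have qint: "(1 - p ^ i) / (1 - q ^ 2) = qint p i" for i
    using p_neq_1 by (simp add: qint_eq q)
  \<comment> \<open>The clauses of \<open>M4_y\<close>; as \<open>l > 1\<close>, the indices 0 and
    \<open>l - 1\<close> differ.\<close>
  consider "k = 0" | "k > 0" "k = l - 1" | "k > 0" "k < l - 1" using \<open>k < l\<close> by linarith
  then have "v * x ^ k * y \<approx>\<^sub>J phi v (M4_y l q \<alpha> \<beta> \<gamma> \<mu> \<mu>2 k)"
  proof cases
    case 1
    then show ?thesis using v_power_x_y[of 0] l phi_vbasis[of 0] phi_vbasis[of 1]
      by (simp add: M4_y_def phi_diff phi_vscale \<tau> mult_ac)
  next
    case 2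
    \<comment> \<open>Here \<open>k + 1 = l\<close>, so the top term wraps around through
      \<open>C\<close>, which acts on \<open>v\<close> by \<mu>.\<close>
    have "(p ^ k * \<gamma> * inverse \<beta>) *s (v * x ^ (k + 1)) \<approx>\<^sub>J (p ^ k * \<gamma> * inverse \<beta>) *s (\<mu> *s v)"
      using 2 v_C by (intro rcong_scale) simp
    from rcong_trans[OF v_power_x_y rcong_add[OF rcong_diff[OF this rcong_refl] rcong_refl]]
    have "v * x ^ k * y \<approx>\<^sub>J (p ^ k * \<gamma> * inverse \<beta>) *s (\<mu> *s v)
        - (p ^ k * inverse \<beta> * \<tau>) *s (v * x ^ k) + (\<alpha> * qint p k) *s (v * x ^ (k - 1))" .
    moreover have "l - 1 = k" "l - 2 = k - 1" using 2 by auto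
    then have "M4_y l q \<alpha> \<beta> \<gamma> \<mu> \<mu>2 k = vscale (\<gamma> * inverse \<beta> * \<mu> * p ^ k) (vbasis 0)
        - vscale (\<mu>2 * inverse \<beta> * p ^ k * (q ^ 2 - 1)) (vbasis k)
        + vscale (qint p k * \<alpha>) (vbasis (k - 1))"
      using 2(1) by (simp only: M4_y_def p_power qint) simp
    ultimately show ?thesis using l \<open>k < l\<close> phi_vbasis[of 0] phi_vbasis[of k] phi_vbasis[of "k - 1"]
      by (simp add: phi_diff phi_add phi_vscale \<tau> mult_ac)
  next
    case 3
    then have "M4_y l q \<alpha> \<beta> \<gamma> \<mu> \<mu>2 k = vscale (\<gamma> * inverse \<beta> * p ^ k) (vbasis (k + 1))
        - vscale (\<mu>2 * inverse \<beta> * p ^ k * (q ^ 2 - 1)) (vbasis k)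
        + vscale (qint p k * \<alpha>) (vbasis (k - 1))"
      by (simp only: M4_y_def p_power qint) simp
    then show ?thesis
      using 3 v_power_x_y[of k] phi_vbasis[of "k + 1"] phi_vbasis[of k] phi_vbasis[of "k - 1"]
      by (simp add: phi_diff phi_add phi_vscale \<tau> mult_ac)
  qed
  then show ?thesis by (rule rcong_sym)
qed

lemma phi_M4_z:
  assumes q: "p = q ^ 2" and "k < l"
  shows "phi v (M4_z q \<beta> k) \<approx>\<^sub>J v * x ^ k * z"
proof (cases "k = 0")
  case True
  then show ?thesis using v(1) by (auto simp: M4_z_def V_def rcong_0_iff intro: rcong_sym)
next
  case False
  \<comment> \<open>With \<open>i = k\<close> in the numerator and \<open>i = 1\<close> in the
    denominator, this turns the fraction in \<open>M4_z\<close> into a quantum integer of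
    \<open>inverse p\<close>.\<close>
  have "q powi (- 2 * int i) = inverse p ^ i" for i
    by (simp add: q power_int_def nat_mult_distrib power_mult power_inverse)
  from this[of k] this[of 1] have "(1 - q powi (- 2 * int k)) / (1 - q powi - 2) = qint (inverse p) k"
    using p_neq_1 by (simp add: qint_eq)
  then show ?thesis using False V_power_x_z[OF v(1), of k] \<open>k < l\<close> phi_vbasis[of "k - 1"]
    by (auto simp: M4_z_def phi_vscale intro: rcong_sym)
qed

lemma phi_M4_gen:
  assumes q: "p = q ^ 2" and \<tau>: "\<tau> = \<mu>2 * (q ^ 2 - 1)" and w: "Poly_Mapping.keys w \<subseteq> {..<l}"
  shows "phi v (M4_gen l q \<alpha> \<beta> \<gamma> \<mu> \<mu>2 g w) \<approx>\<^sub>J phi v w * (case g of GX \<Rightarrow> x | GY \<Rightarrow> y | GZ \<Rightarrow> z)"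
proof -
  have "phi v ((case g of GX \<Rightarrow> M4_x l \<mu> | GY \<Rightarrow> M4_y l q \<alpha> \<beta> \<gamma> \<mu> \<mu>2 | GZ \<Rightarrow> M4_z q \<beta>) k)
      \<approx>\<^sub>J v * x ^ k * (case g of GX \<Rightarrow> x | GY \<Rightarrow> y | GZ \<Rightarrow> z)" if "k < l" for k
    using that q \<tau> by (cases g) (simp_all add: phi_M4_x phi_M4_y phi_M4_z)
  then have "(\<Sum>k\<in>Poly_Mapping.keys w. Poly_Mapping.lookup w k *s phi v
        ((case g of GX \<Rightarrow> M4_x l \<mu> | GY \<Rightarrow> M4_y l q \<alpha> \<beta> \<gamma> \<mu> \<mu>2 | GZ \<Rightarrow> M4_z q \<beta>) k))
      \<approx>\<^sub>J (\<Sum>k\<in>Poly_Mapping.keys w. Poly_Mapping.lookup w k *s (v * x ^ k *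
        (case g of GX \<Rightarrow> x | GY \<Rightarrow> y | GZ \<Rightarrow> z)))"
    using w by (intro rcong_sum rcong_scale) auto
  then show ?thesis
    by (simp add: M4_gen_def linear_ext_def phi_sum phi_vscale phi_keys[OF w] sum_distrib_right
        mult_scale_left)
qed

end

section \<open>The free algebra and its action on M_4\<close>

lemma poly_mapping_eq_sum_single:
  "f = (\<Sum>k\<in>Poly_Mapping.keys f. Poly_Mapping.single k (Poly_Mapping.lookup f k))"
  by (rule poly_mapping_eqI) (auto simp: lookup_sum lookup_single when_def in_keys_iff)

lemma single_eq_const_mult:
  "Poly_Mapping.single w c = free_const c * Poly_Mapping.single w 1"
  by (simp add: free_const_def mult_single)

text \<open>Scalars sit on the empty word, which is neutral on both sides; expanding
  \<open>a\<close> into monomials reduces the claim to this.\<close>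

lemma free_const_commute: "a * free_const c = free_const c * a"
proof -
  have "(\<Sum>k\<in>S. Poly_Mapping.single k (f k)) * free_const c
      = free_const c * (\<Sum>k\<in>S. Poly_Mapping.single k (f k))" for S f
    by (simp add: free_const_def sum_distrib_left sum_distrib_right mult_single mult.commute)
  then show ?thesis using poly_mapping_eq_sum_single[of a] by metis
qed

interpretation free_alg: scaled_algebra "\<lambda>c a. free_const c * a :: 'k::field free_alg"
proof
  fix c d :: 'k and a b :: "'k free_alg"
  show "free_const (c + d) * a = free_const c * a + free_const d * a"
    by (simp add: free_const_def single_add distrib_right)
  show "free_const c * (free_const d * a) = free_const (c * d) * a"
    by (simp add: free_const_def mult_single flip: mult.assoc)
  show "a * (free_const c * b) = free_const c * (a * b)"
    by (simp add: free_const_commute flip: mult.assoc)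
qed (simp_all add: distrib_left mult.assoc free_const_def)

lemma single_Word_Cons:
  "Poly_Mapping.single (Word (g # xs)) 1 = free_gen g * Poly_Mapping.single (Word xs) 1"
  by (simp add: free_gen_def mult_single plus_word_def)

lemma single_Word_Nil: "Poly_Mapping.single (Word []) 1 = (1 :: 'k::field free_alg)"
  using single_one by (simp flip: zero_word_def)

text \<open>\<open>r\<close> is a linear combination of words, and a word is multiplied in from the
  right letter by letter, its first letter first. This reduces closure under right multiplication to
  the generators.\<close>

lemma free_alg_right_closed:
  fixes N :: "'k::field free_alg set"
  assumes diff: "\<And>a b. a \<in> N \<Longrightarrow> b \<in> N \<Longrightarrow> a - b \<in> N"
    and scale: "\<And>c a. a \<in> N \<Longrightarrow> free_const c * a \<in> N"
    and gen: "\<And>g a. a \<in> N \<Longrightarrow> a * free_gen g \<in> N"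
    and a: "a \<in> N"
  shows "a * r \<in> N"
proof -
  have zero: "0 \<in> N" using diff[OF a a] by simp
  have add: "b + c \<in> N" if "b \<in> N" "c \<in> N" for b c
    using diff[OF that(1) diff[OF zero that(2)]] by simp
  have word: "b * Poly_Mapping.single (Word xs) 1 \<in> N" if "b \<in> N" for b xs
    using that
    by (induction xs arbitrary: b)
      (simp_all add: single_Word_Nil single_Word_Cons gen flip: mult.assoc)
  have "b * Poly_Mapping.single w c \<in> N" if "b \<in> N" for b w c
    using scale[OF word[OF that, of "letters w"], of c]
    by (subst single_eq_const_mult) (simp add: free_alg.mult_scale_right)
  then have "(\<Sum>k\<in>S. a * Poly_Mapping.single k (f k)) \<in> N" for S f
    using a by (induction S rule: infinite_finite_induct) (auto intro: zero add)
  then show ?thesis using poly_mapping_eq_sum_single[of r]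
    by (metis sum_distrib_left)
qed

locale free_eigenvector =
  maximal_A_ideal_eigenvector "\<lambda>c a. free_const c * a" J "free_gen GX" "free_gen GY" "free_gen GZ"
    "q ^ 2" \<alpha> \<beta> \<gamma> l n v "\<mu>2 * (q ^ 2 - 1)" \<mu>1
  for J and q \<alpha> \<beta> \<gamma> :: "'k::alg_closed_field" and l n v \<mu>1 \<mu>2
begin

abbreviation "M4_carrier \<equiv> {w :: nat \<Rightarrow>\<^sub>0 'k. Poly_Mapping.keys w \<subseteq> {..<l}}"

text \<open>\<open>fold\<close> applies the first letter first, just as right multiplication by a
  word does, so \<open>phi_M4_gen\<close> can be iterated along the word.\<close>

lemma fold_M4_gen:
  assumes "w \<in> M4_carrier"
  shows "fold (M4_gen l q \<alpha> \<beta> \<gamma> \<mu>1 \<mu>2) xs w \<in> M4_carrier"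
    and "phi v (fold (M4_gen l q \<alpha> \<beta> \<gamma> \<mu>1 \<mu>2) xs w)
      \<approx>\<^sub>J phi v w * Poly_Mapping.single (Word xs) 1"
  using assms
proof (induction xs arbitrary: w)
  case (Cons g xs)
  { case 1
    then have "M4_gen l q \<alpha> \<beta> \<gamma> \<mu>1 \<mu>2 g w \<in> M4_carrier"
      using keys_M4_gen[OF l] by simp
    from Cons.IH(1)[OF this] show ?case by simp }
  { case 2
    let ?w = "M4_gen l q \<alpha> \<beta> \<gamma> \<mu>1 \<mu>2 g w"
    have "phi v (fold (M4_gen l q \<alpha> \<beta> \<gamma> \<mu>1 \<mu>2) xs ?w) \<approx>\<^sub>J phi v ?w * Poly_Mapping.single (Word xs) 1"
      using 2 keys_M4_gen[OF l] by (intro Cons.IH(2)) simp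
    also have "phi v ?w \<approx>\<^sub>J phi v w * free_gen g"
      using phi_M4_gen[OF refl refl, of w g] 2 by (cases g) simp_all
    from rcong_mult[OF this] have "phi v ?w * Poly_Mapping.single (Word xs) 1
        \<approx>\<^sub>J phi v w * Poly_Mapping.single (Word (g # xs)) 1"
      by (simp add: single_Word_Cons mult.assoc)
    finally show ?case by simp }
qed (simp_all add: single_Word_Nil)

lemma M4_free_act:
  assumes "w \<in> M4_carrier"
  shows "M4_free_act l q \<alpha> \<beta> \<gamma> \<mu>1 \<mu>2 w f \<in> M4_carrier"
    and "phi v (M4_free_act l q \<alpha> \<beta> \<gamma> \<mu>1 \<mu>2 w f) \<approx>\<^sub>J phi v w * f"
proof -
  let ?fold = "\<lambda>xs. fold (M4_gen l q \<alpha> \<beta> \<gamma> \<mu>1 \<mu>2) (letters xs) w"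
  have "Poly_Mapping.keys (vscale c (?fold xs)) \<subseteq> {..<l}" for c xs
    using fold_M4_gen(1)[OF assms] keys_vscale by fast
  then show "M4_free_act l q \<alpha> \<beta> \<gamma> \<mu>1 \<mu>2 w f \<in> M4_carrier"
    unfolding M4_free_act_def using Poly_Mapping.keys_sum by fastforce
  have "phi v (M4_free_act l q \<alpha> \<beta> \<gamma> \<mu>1 \<mu>2 w f) =
      (\<Sum>xs\<in>Poly_Mapping.keys f. free_const (Poly_Mapping.lookup f xs) * phi v (?fold xs))"
    by (simp add: M4_free_act_def phi_sum phi_vscale)
  also have "\<dots> \<approx>\<^sub>J (\<Sum>xs\<in>Poly_Mapping.keys f. free_const (Poly_Mapping.lookup f xs) *
      (phi v w * Poly_Mapping.single (Word (letters xs)) 1))"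
    by (intro rcong_sum rcong_scale fold_M4_gen assms)
  also have "\<dots> = phi v w * (\<Sum>xs\<in>Poly_Mapping.keys f. Poly_Mapping.single xs (Poly_Mapping.lookup f xs))"
    by (subst (2) single_eq_const_mult) (simp add: sum_distrib_left free_alg.mult_scale_right)
  finally show "phi v (M4_free_act l q \<alpha> \<beta> \<gamma> \<mu>1 \<mu>2 w f) \<approx>\<^sub>J phi v w * f"
    using poly_mapping_eq_sum_single[of f] by simp
qed

end

section \<open>Transport of structure\<close>

lemma ring_of_type_algebra_simps:
  "carrier (ring_of_type_algebra :: 'a::ring_1 ring) = UNIV"
  "a \<otimes>\<^bsub>ring_of_type_algebra\<^esub> b = a * (b :: 'a)"
  "a \<oplus>\<^bsub>ring_of_type_algebra\<^esub> b = a + (b :: 'a)"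
  "\<one>\<^bsub>ring_of_type_algebra\<^esub> = (1 :: 'a)"
  "\<zero>\<^bsub>ring_of_type_algebra\<^esub> = (0 :: 'a)"
  by (simp_all add: ring_of_type_algebra_def)

lemma ring_of_type_algebra: "ring (ring_of_type_algebra :: 'a::ring_1 ring)"
  by (intro ringI abelian_groupI monoidI)
    (auto simp: ring_of_type_algebra_simps algebra_simps intro: exI[of _ "- _"])

lemma (in right_module) ract_zero_right:
  assumes m: "m \<in> carrier M"
  shows "m \<triangleleft>\<^bsub>M\<^esub> \<zero> = \<zero>\<^bsub>M\<^esub>"
  using ract_add_right[OF m R.zero_closed R.zero_closed] ract_closed[OF m R.zero_closed]
  by (simp add: M.add.r_cancel_one')

lemma (in right_module) ract_zero_left:
  assumes a: "a \<in> carrier R"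
  shows "\<zero>\<^bsub>M\<^esub> \<triangleleft>\<^bsub>M\<^esub> a = \<zero>\<^bsub>M\<^esub>"
  using ract_add_left[OF M.zero_closed M.zero_closed a] ract_closed[OF M.zero_closed a]
  by (simp add: M.add.r_cancel_one')

lemma right_submodule_image:
  assumes M: "right_module R M" and N: "right_module R N"
    and h: "h \<in> carrier N \<rightarrow> carrier M"
      "\<And>m n. m \<in> carrier N \<Longrightarrow> n \<in> carrier N \<Longrightarrow> h (m \<oplus>\<^bsub>N\<^esub> n) = h m \<oplus>\<^bsub>M\<^esub> h n"
      "\<And>m a. m \<in> carrier N \<Longrightarrow> a \<in> carrier R \<Longrightarrow> h (m \<triangleleft>\<^bsub>N\<^esub> a) = h m \<triangleleft>\<^bsub>M\<^esub> a"
    and L: "right_submodule R N L"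
  shows "right_submodule R M (h ` L)"
proof -
  interpret M: right_module R M by (rule M)
  interpret N: right_module R N by (rule N)
  interpret L: additive_subgroup L N using L by (simp add: right_submodule_def)
  interpret h: group_hom "add_monoid N" "add_monoid M" h
    by unfold_locales (use h in \<open>auto simp: hom_def\<close>)
  have "additive_subgroup (h ` L) M"
    by (rule additive_subgroup.intro) (rule h.subgroup_img_is_subgroup[OF L.a_subgroup])
  moreover have "h n \<triangleleft>\<^bsub>M\<^esub> a \<in> h ` L" if "n \<in> L" "a \<in> carrier R" for n a
    using L that h(3)[of n a] L.a_Hcarr unfolding right_submodule_def by (metis imageI)
  ultimately show ?thesis by (auto simp: right_submodule_def)
qed

text \<open>\<open>N\<close> is given only as an abelian group with an operation; injectivity of
  \<open>h\<close> pulls the module axioms back from \<open>M\<close>, and submodules of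
  \<open>N\<close> are compared through their images.\<close>

lemma simple_right_module_transport:
  assumes M: "simple_right_module R M" and N: "abelian_group N"
    and bij: "bij_betw h (carrier N) (carrier M)"
    and add: "\<And>m n. m \<in> carrier N \<Longrightarrow> n \<in> carrier N \<Longrightarrow> h (m \<oplus>\<^bsub>N\<^esub> n) = h m \<oplus>\<^bsub>M\<^esub> h n"
    and ract: "\<And>m a. m \<in> carrier N \<Longrightarrow> a \<in> carrier R \<Longrightarrow> h (m \<triangleleft>\<^bsub>N\<^esub> a) = h m \<triangleleft>\<^bsub>M\<^esub> a"
    and closed: "\<And>m a. m \<in> carrier N \<Longrightarrow> a \<in> carrier R \<Longrightarrow> m \<triangleleft>\<^bsub>N\<^esub> a \<in> carrier N"
  shows "simple_right_module R N \<and> right_modules_isomorphic R M N"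
proof -
  interpret M: right_module R M using M by (simp add: simple_right_module_def)
  interpret N: abelian_group N by (rule N)
  have h: "h m \<in> carrier M" if "m \<in> carrier N" for m
    using bij that by (auto simp: bij_betw_def)
  have inj: "m = n" if "h m = h n" "m \<in> carrier N" "n \<in> carrier N" for m n
    using bij that by (auto simp: bij_betw_def inj_on_def)
  have N': "right_module R N"
    by unfold_locales
      (rule closed inj; simp add: h add ract closed M.ract_add_left M.ract_add_right M.ract_mult M.ract_one)+
  interpret h: group_hom "add_monoid N" "add_monoid M" h
    by unfold_locales (use h add in \<open>auto simp: hom_def\<close>)
  have h_zero: "h \<zero>\<^bsub>N\<^esub> = \<zero>\<^bsub>M\<^esub>" using h.hom_one by simp
  have image: "h ` carrier N = carrier M" using bij by (simp add: bij_betw_def)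
  have simple: "L = {\<zero>\<^bsub>N\<^esub>} \<or> L = carrier N" if L: "right_submodule R N L" for L
  proof -
    have sub: "L \<subseteq> carrier N"
      using L additive_subgroup.a_subset by (auto simp: right_submodule_def)
    have "right_submodule R M (h ` L)"
      using h by (intro right_submodule_image[OF _ N' _ add ract L] M.right_module_axioms) auto
    then have "h ` L = {\<zero>\<^bsub>M\<^esub>} \<or> h ` L = carrier M"
      using M by (simp add: simple_right_module_def)
    then have "h ` L = h ` {\<zero>\<^bsub>N\<^esub>} \<or> h ` L = h ` carrier N"
      by (simp add: h_zero image)
    moreover have "{\<zero>\<^bsub>N\<^esub>} \<subseteq> carrier N" by simp
    ultimately show ?thesis
      using inj_on_image_eq_iff[of h "carrier N"] bij sub unfolding bij_betw_def by blast
  qed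
  moreover have "carrier N \<noteq> {\<zero>\<^bsub>N\<^esub>}"
    using M image h_zero by (auto simp: simple_right_module_def)
  \<comment> \<open>\<open>h\<close> runs from \<open>N\<close> to \<open>M\<close>, while the
    isomorphism is required from \<open>M\<close> to \<open>N\<close>.\<close>
  moreover have "inv_into (carrier N) h \<in> right_module_iso R M N"
  proof -
    let ?g = "inv_into (carrier N) h"
    have g: "?g m \<in> carrier N" "h (?g m) = m" if "m \<in> carrier M" for m
      using that image by (auto intro: inv_into_into f_inv_into_f)
    have "?g (m \<oplus>\<^bsub>M\<^esub> n) = ?g m \<oplus>\<^bsub>N\<^esub> ?g n" if "m \<in> carrier M" "n \<in> carrier M" for m n
      using that by (intro inj) (simp_all add: g add)
    moreover have "?g (m \<triangleleft>\<^bsub>M\<^esub> a) = ?g m \<triangleleft>\<^bsub>N\<^esub> a" if "m \<in> carrier M" "a \<in> carrier R" for m a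
      using that by (intro inj) (simp_all add: g ract closed M.ract_closed)
    ultimately show ?thesis
      using bij_betw_inv_into[OF bij] by (simp add: right_module_iso_def)
  qed
  ultimately show ?thesis
    using N' M.right_module_axioms
    by (auto simp: simple_right_module_def right_modules_isomorphic_def)
qed

section \<open>The additive group of M_4 and the projection onto the quotient algebra\<close>

lemma M4_abelian_group: "abelian_group (M4 l q \<alpha> \<beta> \<gamma> \<mu>1 \<mu>2)"
proof (rule abelian_groupI)
  fix v assume "v \<in> carrier (M4 l q \<alpha> \<beta> \<gamma> \<mu>1 \<mu>2)"
  then show "\<exists>w\<in>carrier (M4 l q \<alpha> \<beta> \<gamma> \<mu>1 \<mu>2). w \<oplus>\<^bsub>M4 l q \<alpha> \<beta> \<gamma> \<mu>1 \<mu>2\<^esub> v = \<zero>\<^bsub>M4 l q \<alpha> \<beta> \<gamma> \<mu>1 \<mu>2\<^esub>"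
    by (intro bexI[of _ "- v"]) (auto simp: M4_def in_keys_iff)
next
  fix v w
  assume "v \<in> carrier (M4 l q \<alpha> \<beta> \<gamma> \<mu>1 \<mu>2)" "w \<in> carrier (M4 l q \<alpha> \<beta> \<gamma> \<mu>1 \<mu>2)"
  then show "v \<oplus>\<^bsub>M4 l q \<alpha> \<beta> \<gamma> \<mu>1 \<mu>2\<^esub> w \<in> carrier (M4 l q \<alpha> \<beta> \<gamma> \<mu>1 \<mu>2)"
    using Poly_Mapping.keys_add[of v w] by (auto simp: M4_def)
qed (auto simp: M4_def algebra_simps)

lemma A_ideal: "ideal (A_ideal q \<alpha> \<beta> \<gamma>) free_ring"
  unfolding A_ideal_def
  by (intro ring.genideal_ideal ring_of_type_algebra) (simp add: ring_of_type_algebra_simps)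

lemma A_relators_subset: "A_relators q \<alpha> \<beta> \<gamma> \<subseteq> A_ideal q \<alpha> \<beta> \<gamma>"
  unfolding A_ideal_def
  by (intro ring.genideal_self ring_of_type_algebra) (simp add: ring_of_type_algebra_simps)

text \<open>The canonical projection from the free algebra; \<open>A_gen\<close> is its value at a
  generator.\<close>

definition A_proj :: "'k::field \<Rightarrow> 'k \<Rightarrow> 'k \<Rightarrow> 'k \<Rightarrow> 'k free_alg \<Rightarrow> 'k free_alg set" where
  "A_proj q \<alpha> \<beta> \<gamma> f = A_ideal q \<alpha> \<beta> \<gamma> +>\<^bsub>free_ring\<^esub> f"

lemma A_proj_add: "A_proj q \<alpha> \<beta> \<gamma> (f + g) = A_proj q \<alpha> \<beta> \<gamma> f \<oplus>\<^bsub>A_alg q \<alpha> \<beta> \<gamma>\<^esub> A_proj q \<alpha> \<beta> \<gamma> g"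
  and A_proj_mult: "A_proj q \<alpha> \<beta> \<gamma> (f * g) = A_proj q \<alpha> \<beta> \<gamma> f \<otimes>\<^bsub>A_alg q \<alpha> \<beta> \<gamma>\<^esub> A_proj q \<alpha> \<beta> \<gamma> g"
  and A_proj_one: "A_proj q \<alpha> \<beta> \<gamma> 1 = \<one>\<^bsub>A_alg q \<alpha> \<beta> \<gamma>\<^esub>"
  using ring_hom_memE[OF ideal.rcos_ring_hom[OF A_ideal[of q \<alpha> \<beta> \<gamma>]]]
  by (simp_all add: A_proj_def A_alg_def ring_of_type_algebra_simps)

lemma carrier_A_alg: "carrier (A_alg q \<alpha> \<beta> \<gamma>) = range (A_proj q \<alpha> \<beta> \<gamma>)"
  by (auto simp: A_alg_def A_proj_def FactRing_def A_RCOSETS_defs a_r_coset_def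
      ring_of_type_algebra_simps)

lemma A_proj_power: "A_proj q \<alpha> \<beta> \<gamma> (f ^ n) = A_proj q \<alpha> \<beta> \<gamma> f [^]\<^bsub>A_alg q \<alpha> \<beta> \<gamma>\<^esub> n"
  by (induction n) (simp_all add: A_proj_one A_proj_mult nat_pow_def power_Suc2 del: power_Suc)

lemma A_proj_ideal: "f \<in> A_ideal q \<alpha> \<beta> \<gamma> \<Longrightarrow> A_proj q \<alpha> \<beta> \<gamma> f = \<zero>\<^bsub>A_alg q \<alpha> \<beta> \<gamma>\<^esub>"
proof -
  assume f: "f \<in> A_ideal q \<alpha> \<beta> \<gamma>"
  interpret ideal "A_ideal q \<alpha> \<beta> \<gamma>" free_ring by (rule A_ideal)
  show ?thesis using a_rcos_const[OF f] by (simp add: A_proj_def A_alg_def FactRing_def)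
qed

lemma A_proj_self: "f \<in> A_proj q \<alpha> \<beta> \<gamma> f"
  and A_proj_eq: "g \<in> A_proj q \<alpha> \<beta> \<gamma> f \<Longrightarrow> A_proj q \<alpha> \<beta> \<gamma> g = A_proj q \<alpha> \<beta> \<gamma> f"
proof -
  interpret ideal "A_ideal q \<alpha> \<beta> \<gamma>" free_ring by (rule A_ideal)
  show "f \<in> A_proj q \<alpha> \<beta> \<gamma> f"
    unfolding A_proj_def by (rule a_rcos_self) (simp add: ring_of_type_algebra_simps)
  show "A_proj q \<alpha> \<beta> \<gamma> g = A_proj q \<alpha> \<beta> \<gamma> f" if "g \<in> A_proj q \<alpha> \<beta> \<gamma> f"
    using that a_repr_independence' unfolding A_proj_def
    by (simp add: ring_of_type_algebra_simps)
qed

theorem theorem6p3: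
  fixes q \<alpha> \<beta> \<gamma> :: "'k::alg_closed_field"
    and l :: nat
    and M :: "('k free_alg set, 'm) rmodule"
  assumes "q \<noteq> 0"
    and "primitive_root_of_unity l (q ^ 2)"
    and "l > 1"
    and "\<beta> \<noteq> 0"
    and "simple_right_module (A_alg q \<alpha> \<beta> \<gamma>) M"
    and "acts_nilpotently (A_alg q \<alpha> \<beta> \<gamma>) M (A_gen q \<alpha> \<beta> \<gamma> GZ)"
  shows "\<exists>\<mu>1 \<mu>2. simple_right_module (A_alg q \<alpha> \<beta> \<gamma>) (M4 l q \<alpha> \<beta> \<gamma> \<mu>1 \<mu>2) \<and>
           right_modules_isomorphic (A_alg q \<alpha> \<beta> \<gamma>) M (M4 l q \<alpha> \<beta> \<gamma> \<mu>1 \<mu>2)"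
proof -
  let ?A = "A_alg q \<alpha> \<beta> \<gamma>"
  note simple = assms(5)
  define pr where "pr = A_proj q \<alpha> \<beta> \<gamma>"
  interpret right_module ?A M using simple by (simp add: simple_right_module_def)
  have pr_carrier: "pr f \<in> carrier ?A" for f by (simp add: pr_def carrier_A_alg)
  obtain m0 where m0: "m0 \<in> carrier M" "m0 \<noteq> \<zero>\<^bsub>M\<^esub>"
    using simple M.zero_closed unfolding simple_right_module_def by blast
  \<comment> \<open>The orbit map of a nonzero vector; its kernel \<open>J\<close> presents
    \<open>M\<close> as a quotient of the free algebra.\<close>
  define \<psi> where "\<psi> f = m0 \<triangleleft>\<^bsub>M\<^esub> pr f" for f
  have \<psi>_carrier: "\<psi> f \<in> carrier M" for f
    by (simp add: \<psi>_def ract_closed m0 pr_carrier)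
  have \<psi>_add: "\<psi> (f + g) = \<psi> f \<oplus>\<^bsub>M\<^esub> \<psi> g" for f g
    using ract_add_right[OF m0(1) pr_carrier pr_carrier] by (simp add: \<psi>_def pr_def A_proj_add)
  have \<psi>_mult: "\<psi> (f * g) = \<psi> f \<triangleleft>\<^bsub>M\<^esub> pr g" for f g
    using ract_mult[OF m0(1) pr_carrier pr_carrier] by (simp add: \<psi>_def pr_def A_proj_mult)
  have \<psi>_1: "\<psi> 1 = m0"
    using ract_one[OF m0(1)] by (simp add: \<psi>_def pr_def A_proj_one)
  have \<psi>_0: "\<psi> 0 = \<zero>\<^bsub>M\<^esub>"
    using \<psi>_add[of 0 0] \<psi>_carrier by (simp add: M.add.r_cancel_one')
  define J where "J = {f. \<psi> f = \<zero>\<^bsub>M\<^esub>}"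
  have \<psi>_diff: "\<psi> (f - g) \<oplus>\<^bsub>M\<^esub> \<psi> g = \<psi> f" for f g
    using \<psi>_add[of "f - g" g] by simp
  have \<psi>_eq: "\<psi> f = \<psi> g \<longleftrightarrow> f - g \<in> J" for f g
    using \<psi>_diff[of f g] \<psi>_carrier[of g] \<psi>_carrier[of "f - g"]
    by (metis (mono_tags) J_def M.l_zero M.add.r_cancel M.zero_closed mem_Collect_eq)
  have J: "right_ideal (\<lambda>c a. free_const c * a) J"
  proof
    show "0 \<in> J" by (simp add: J_def \<psi>_0)
    show "a - b \<in> J" if "a \<in> J" "b \<in> J" for a b
      using that \<psi>_eq[of a b] by (simp add: J_def)
    show "a * r \<in> J" if "a \<in> J" for a r
      using that by (simp add: J_def \<psi>_mult ract_zero_left pr_carrier)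
  qed
  interpret J: right_ideal "\<lambda>c a. free_const c * a" J by (rule J)
  \<comment> \<open>The image of a right ideal not contained in \<open>J\<close> is a nonzero
    submodule, hence all of \<open>M\<close>.\<close>
  have image_\<psi>: "\<psi> ` N = carrier M"
    if N: "\<And>a b. a \<in> N \<Longrightarrow> b \<in> N \<Longrightarrow> a - b \<in> N" "\<And>a r. a \<in> N \<Longrightarrow> a * r \<in> N"
      and a: "a \<in> N" "a \<notin> J" for N a
  proof -
    have zero_N: "0 \<in> N" using N(1)[OF a(1) a(1)] by simp
    have "subgroup (\<psi> ` N) (add_monoid M)"
    proof (rule M.add.subgroupI)
      fix m n assume "m \<in> \<psi> ` N" "n \<in> \<psi> ` N"
      then obtain f g where fg: "f \<in> N" "g \<in> N" and "m = \<psi> f" "n = \<psi> g" by blast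
      then have "m \<oplus>\<^bsub>M\<^esub> n = \<psi> (f - (0 - g))" by (simp flip: \<psi>_add)
      then show "m \<oplus>\<^bsub>M\<^esub> n \<in> \<psi> ` N"
        using N(1)[OF fg(1) N(1)[OF zero_N fg(2)]] by blast
    next
      fix m assume "m \<in> \<psi> ` N"
      then obtain f where f: "f \<in> N" "m = \<psi> f" by blast
      have "\<ominus>\<^bsub>M\<^esub> m = \<psi> (0 - f)"
        using \<psi>_diff[of 0 f] \<psi>_carrier by (intro M.minus_equality) (simp_all add: f \<psi>_0)
      then show "\<ominus>\<^bsub>M\<^esub> m \<in> \<psi> ` N" using N(1)[OF zero_N f(1)] by blast
    qed (use a \<psi>_carrier in auto)
    moreover have "\<psi> f \<triangleleft>\<^bsub>M\<^esub> a \<in> \<psi> ` N" if "f \<in> N" "a \<in> carrier ?A" for f a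
      using that N(2) by (auto simp: carrier_A_alg simp flip: pr_def \<psi>_mult)
    ultimately have "right_submodule ?A M (\<psi> ` N)"
      by (auto simp: right_submodule_def additive_subgroup_def)
    moreover have "\<psi> ` N \<noteq> {\<zero>\<^bsub>M\<^esub>}" using a by (auto simp: J_def)
    ultimately show ?thesis using simple by (auto simp: simple_right_module_def)
  qed
  have proper: "1 \<notin> J" using m0 by (simp add: J_def \<psi>_1)
  have ideal_J: "u * r \<in> J" if "r \<in> A_ideal q \<alpha> \<beta> \<gamma>" for u r
    using that by (simp add: J_def \<psi>_mult pr_def A_proj_ideal ract_zero_right \<psi>_carrier)
  \<comment> \<open>Relators act as zero on \<open>M\<close>, so the two sides of each defining
    relation act alike.\<close>
  have relator: "J.acong a b" if "a - b \<in> A_relators q \<alpha> \<beta> \<gamma>" for a b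
    using ideal_J[OF subsetD[OF A_relators_subset that]]
    by (simp add: J.acong_def J.rcong_def flip: right_diff_distrib)
  obtain n where n: "\<And>m. m \<in> carrier M \<Longrightarrow> m \<triangleleft>\<^bsub>M\<^esub> pr (free_gen GZ ^ n) = \<zero>\<^bsub>M\<^esub>"
    using assms(6) by (auto simp: acts_nilpotently_def A_gen_def pr_def A_proj_power simp flip: A_proj_def)
  interpret E: maximal_A_ideal "\<lambda>c a. free_const c * a" J "free_gen GX" "free_gen GY" "free_gen GZ"
    "q ^ 2" \<alpha> \<beta> \<gamma> l n
  proof
    show "J.acong (free_gen GX * free_gen GY)
        (free_const (q ^ 2) * (free_gen GY * free_gen GX) + free_const \<alpha> * 1)"
      "J.acong (free_gen GX * free_gen GZ)
        (free_const (inverse (q ^ 2)) * (free_gen GZ * free_gen GX) + free_const \<beta> * 1)"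
      "J.acong (free_gen GY * free_gen GZ)
        (free_const (q ^ 2) * (free_gen GZ * free_gen GY) + free_const \<gamma> * 1)"
      by (auto intro!: relator simp: A_relators_def Let_def power_int_minus)
    show "1 \<notin> J" by (rule proper)
    show "u * free_gen GZ ^ n \<in> J" for u
      by (simp add: J_def \<psi>_mult n \<psi>_carrier)
    show "b \<in> N"
      if "J \<subseteq> N" and diff: "\<And>a b. a \<in> N \<Longrightarrow> b \<in> N \<Longrightarrow> a - b \<in> N"
        and scale: "\<And>c a. a \<in> N \<Longrightarrow> free_const c * a \<in> N"
        and gen: "\<And>g a. g \<in> {free_gen GX, free_gen GY, free_gen GZ} \<Longrightarrow> a \<in> N \<Longrightarrow> a * g \<in> N"
        and a: "a \<in> N" "a \<notin> J" for N a b
    proof -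
      have free_gen: "c * free_gen g \<in> N" if "c \<in> N" for c g
        using gen[OF _ that] by (cases g) auto
      have mult_N: "c * r \<in> N" if "c \<in> N" for c r
        by (rule free_alg_right_closed[OF diff scale free_gen that])
      have "\<psi> ` N = carrier M" by (rule image_\<psi>[OF diff mult_N a])
      \<comment> \<open>Some \<open>c\<close> in \<open>N\<close> has the same image as
        \<open>b\<close>; the difference lies in \<open>J\<close> and therefore in
        \<open>N\<close>.\<close>
      then obtain c where c: "c \<in> N" "\<psi> b = \<psi> c" using \<psi>_carrier[of b] by auto
      then have "b - c \<in> N" using \<open>J \<subseteq> N\<close> \<psi>_eq by auto
      moreover have "0 - c \<in> N" using diff[OF diff[OF c(1) c(1)] c(1)] by simp
      ultimately have "(b - c) - (0 - c) \<in> N" by (rule diff)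
      then show ?thesis by simp
    qed
  qed (use assms in auto)
  obtain v \<tau> \<mu>1 where v: "v \<in> E.V" "v \<notin> J" "J.rcong (v * E.T) (free_const \<tau> * v)"
    "J.rcong (v * free_gen GX ^ l) (free_const \<mu>1 * v)"
    by (rule E.ex_eigenvector)
  \<comment> \<open>The value for which the diagonal coefficient in \<open>M4_y\<close> reproduces
    the eigenvalue \<tau>; q^2 differs from 1.\<close>
  define \<mu>2 where "\<mu>2 = \<tau> / (q ^ 2 - 1)"
  have \<tau>: "\<tau> = \<mu>2 * (q ^ 2 - 1)" using E.p_neq_1 by (simp add: \<mu>2_def)
  interpret E: free_eigenvector J q \<alpha> \<beta> \<gamma> l n v \<mu>1 \<mu>2
    by unfold_locales (use v \<tau> in auto)
  let ?M4 = "M4 l q \<alpha> \<beta> \<gamma> \<mu>1 \<mu>2"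
  let ?h = "\<lambda>w. \<psi> (E.phi v w)"
  have carrier_M4: "carrier ?M4 = E.M4_carrier" by (simp add: M4_def)
  have \<psi>_cong: "\<psi> f = \<psi> g \<longleftrightarrow> J.rcong f g" for f g
    by (simp add: \<psi>_eq J.rcong_def)
  have h_inj: "w = w'" if "?h w = ?h w'" "w \<in> E.M4_carrier" "w' \<in> E.M4_carrier" for w w'
  proof -
    have "E.phi v (w - w') \<in> J" using that(1) by (simp add: \<psi>_eq E.phi_diff)
    moreover have "Poly_Mapping.keys (w - w') \<subseteq> {..<l}"
      using that(2,3) Poly_Mapping.keys_diff[of w w'] by auto
    ultimately have "w - w' = 0" using E.phi_eq_0 v by blast
    then show ?thesis by simp
  qed
  have h_surj: "m \<in> ?h ` E.M4_carrier" if "m \<in> carrier M" for m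
  proof -
    \<comment> \<open>The whole free algebra is a right ideal containing 1, which is outside
      \<open>J\<close>.\<close>
    have "range \<psi> = carrier M"
      by (rule image_\<psi>[OF _ _ UNIV_I proper]) simp_all
    then have "m \<in> range \<psi>" using that by simp
    then obtain f where "m = \<psi> f" by (rule rangeE)
    moreover obtain w where "w \<in> E.M4_carrier" "J.rcong f (E.phi v w)"
      using E.phi_surj[of f] by auto
    ultimately show ?thesis by (auto simp: \<psi>_cong)
  qed
  \<comment> \<open>Members of one coset send \<open>w\<close> to elements with equal image under
    \<open>?h\<close>. By injectivity they act alike, and \<open>the_elem\<close> returns the common
    value.\<close>
  have ract_M4: "w \<triangleleft>\<^bsub>?M4\<^esub> pr f = M4_free_act l q \<alpha> \<beta> \<gamma> \<mu>1 \<mu>2 w f" if w: "w \<in> E.M4_carrier" for w f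
  proof -
    have "M4_free_act l q \<alpha> \<beta> \<gamma> \<mu>1 \<mu>2 w g = M4_free_act l q \<alpha> \<beta> \<gamma> \<mu>1 \<mu>2 w f" if "g \<in> pr f" for g
    proof (rule h_inj[OF _ E.M4_free_act(1)[OF w] E.M4_free_act(1)[OF w]])
      have "\<psi> (E.phi v w * g) = \<psi> (E.phi v w * f)"
        using A_proj_eq[of g] that by (simp add: \<psi>_mult pr_def)
      then show "?h (M4_free_act l q \<alpha> \<beta> \<gamma> \<mu>1 \<mu>2 w g) = ?h (M4_free_act l q \<alpha> \<beta> \<gamma> \<mu>1 \<mu>2 w f)"
        using E.M4_free_act(2)[OF w] unfolding \<psi>_cong[symmetric] by simp
    qed
    then have "M4_free_act l q \<alpha> \<beta> \<gamma> \<mu>1 \<mu>2 w ` pr f = (\<lambda>_. M4_free_act l q \<alpha> \<beta> \<gamma> \<mu>1 \<mu>2 w f) ` pr f"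
      by (intro image_cong refl)
    also have "\<dots> = {M4_free_act l q \<alpha> \<beta> \<gamma> \<mu>1 \<mu>2 w f}"
      using A_proj_self unfolding pr_def by (rule image_constant)
    finally have "M4_free_act l q \<alpha> \<beta> \<gamma> \<mu>1 \<mu>2 w ` pr f = {M4_free_act l q \<alpha> \<beta> \<gamma> \<mu>1 \<mu>2 w f}" .
    then show ?thesis by (simp add: M4_def)
  qed
  have "simple_right_module ?A ?M4 \<and> right_modules_isomorphic ?A M ?M4"
  proof (rule simple_right_module_transport[OF simple M4_abelian_group])
    show "bij_betw ?h (carrier ?M4) (carrier M)"
      using h_inj h_surj \<psi>_carrier by (auto simp: bij_betw_def inj_on_def carrier_M4)
    show "?h (w \<oplus>\<^bsub>?M4\<^esub> w') = ?h w \<oplus>\<^bsub>M\<^esub> ?h w'" for w w'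
      by (simp add: M4_def E.phi_add \<psi>_add)
    fix w a assume w: "w \<in> carrier ?M4" and "a \<in> carrier ?A"
    then obtain f where f: "a = pr f" by (auto simp: carrier_A_alg pr_def)
    show "?h (w \<triangleleft>\<^bsub>?M4\<^esub> a) = ?h w \<triangleleft>\<^bsub>M\<^esub> a"
      using w ract_M4[of w f] E.M4_free_act(2)[of w f]
      by (simp add: f carrier_M4 \<psi>_cong flip: \<psi>_mult)
    show "w \<triangleleft>\<^bsub>?M4\<^esub> a \<in> carrier ?M4"
      using w ract_M4[of w f] E.M4_free_act(1)[of w f] by (simp add: f carrier_M4)
  qed
  then show ?thesis by blast
qed

end
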